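(* For every odd positive integer $n$, there exist a $\mathrm{TOC}_4(7^n+1,5,3)$ and a $\mathrm{TOC}_3(8^n+1,5,3)$.
   Context: $\mathcal{H}_q(n,w)$ is the set of all words of length $n$ over $\mathbb{Z}_q$ with exactly $w$ nonzero entries, with the Hamming distance. An $(n,d,w)_q$-code is a nonempty subset of $\mathcal{H}_q(n,w)$ in which any two distinct words have Hamming distance at least $d$; $A_q(n,d,w)$ is the maximum size of such a code and a code of this size is optimal. A $\mathrm{TOC}_q(n,d,w)$ is a partition of $\mathcal{H}_q(n,w)$ into mutually disjoint optimal $(n,d,w)_q$-codes. *)

theory Defs
  imports Main
begin

text \<open>Words of length n over Z_q are represented as lists of naturals of length n
  with entries in {0..<q}; the symbol 0 is the zero of Z_q.\<close>

definition hamming_dist :: "nat list \<Rightarrow> nat list \<Rightarrow> nat" where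
  "hamming_dist x y = card {i. i < length x \<and> x ! i \<noteq> y ! i}"

definition weight :: "nat list \<Rightarrow> nat" where
  "weight x = card {i. i < length x \<and> x ! i \<noteq> 0}"

definition Hq :: "nat \<Rightarrow> nat \<Rightarrow> nat \<Rightarrow> nat list set" where
  "Hq q n w = {x. length x = n \<and> set x \<subseteq> {0..<q} \<and> weight x = w}"

definition is_code :: "nat \<Rightarrow> nat \<Rightarrow> nat \<Rightarrow> nat \<Rightarrow> nat list set \<Rightarrow> bool" where
  "is_code q n d w C \<longleftrightarrow> C \<noteq> {} \<and> C \<subseteq> Hq q n w \<and>
     (\<forall>x\<in>C. \<forall>y\<in>C. x \<noteq> y \<longrightarrow> d \<le> hamming_dist x y)"

definition Aq :: "nat \<Rightarrow> nat \<Rightarrow> nat \<Rightarrow> nat \<Rightarrow> nat" where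
  "Aq q n d w = Max (card ` {C. is_code q n d w C})"

definition optimal_code :: "nat \<Rightarrow> nat \<Rightarrow> nat \<Rightarrow> nat \<Rightarrow> nat list set \<Rightarrow> bool" where
  "optimal_code q n d w C \<longleftrightarrow> is_code q n d w C \<and> card C = Aq q n d w"

definition is_TOC :: "nat \<Rightarrow> nat \<Rightarrow> nat \<Rightarrow> nat \<Rightarrow> nat list set set \<Rightarrow> bool" where
  "is_TOC q n d w P \<longleftrightarrow> \<Union>P = Hq q n w \<and>
     (\<forall>C\<in>P. optimal_code q n d w C) \<and>
     (\<forall>C\<in>P. \<forall>D\<in>P. C \<noteq> D \<longrightarrow> C \<inter> D = {})"

end

theory Submission
  imports Defs "Berlekamp_Zassenhaus.Finite_Field" "HOL-Algebra.Algebraic_Closure_Type"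
    "HOL-Library.Disjoint_Sets"
begin

text \<open>
  In a code of weight \<open>w\<close> and distance \<open>2 w - 1\<close> every pair of a position and a nonzero symbol
  occurs at most once. Codes in which every such pair occurs exactly once are called saturated here;
  they are optimal.

  Let \<open>q\<close> be a prime power and \<open>Q = q ^ n\<close>. The images of the projective line over \<open>F\<^sub>q\<close> form a
  Steiner system of blocks of size \<open>q + 1\<close> on the projective line over \<open>F\<^sub>Q\<close>. For \<open>\<tau>\<close> in the
  quadratic extension of \<open>F\<^sub>Q\<close>, outside \<open>F\<^sub>Q\<close>, the Cayley map \<open>x \<mapsto> (x - \<tau>) / (x - \<tau> ^ Q)\<close>
  identifies the line with the group of \<open>(Q + 1)\<close>-th roots of unity. If \<open>n\<close> is odd, this group
  contains the \<open>(q + 1)\<close>-th roots of unity, and their cosets pull back to a parallel class of blocks.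
  The conjugates \<open>\<tau>\<close> and \<open>\<tau> ^ Q\<close> give the same class, and every block lies in exactly
  \<open>q choose 2\<close> of these classes. If the words of weight 3 on \<open>q + 1\<close> points over \<open>r\<close> symbols split
  into saturated codes, then there are \<open>(q choose 2) * (r - 1)\<^sup>2\<close> of these codes, so each class
  through a block can be given \<open>(r - 1)\<^sup>2\<close> of the codes on the block for itself. Uniting them over
  the blocks of a class gives saturated codes of length \<open>Q + 1\<close>. What remains is to split the words
  on 8 points over 4 symbols and on 9 points over 3 symbols.
\<close>

section \<open>Saturated codes\<close>

definition supp :: "('a \<Rightarrow> nat) \<Rightarrow> 'a set" where
  "supp f = {p. f p \<noteq> 0}"

definition words :: "nat \<Rightarrow> nat \<Rightarrow> 'a set \<Rightarrow> ('a \<Rightarrow> nat) set" where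
  "words q w V = {f. (\<forall>p. f p < q) \<and> supp f \<subseteq> V \<and> card (supp f) = w}"

definition saturated_code :: "nat \<Rightarrow> nat \<Rightarrow> 'a set \<Rightarrow> ('a \<Rightarrow> nat) set \<Rightarrow> bool" where
  "saturated_code q w V C \<longleftrightarrow> C \<subseteq> words q w V \<and>
     (\<forall>p\<in>V. \<forall>a\<in>{1..<q}. \<exists>!f. f \<in> C \<and> f p = a) \<and>
     (\<forall>f\<in>C. \<forall>g\<in>C. f \<noteq> g \<longrightarrow> card (supp f \<inter> supp g) \<le> 1)"

definition tiling :: "nat \<Rightarrow> nat \<Rightarrow> 'a set \<Rightarrow> 'j set \<Rightarrow> ('j \<Rightarrow> ('a \<Rightarrow> nat) set) \<Rightarrow> bool" where
  "tiling q w V J C \<longleftrightarrow> (\<forall>j\<in>J. saturated_code q w V (C j)) \<and>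
     (\<forall>f\<in>words q w V. \<exists>!j. j \<in> J \<and> f \<in> C j)"

lemma wordsD:
  assumes "f \<in> words q w V"
  shows "f p < q" "supp f \<subseteq> V" "card (supp f) = w" "p \<in> supp f \<Longrightarrow> f p \<in> {1..<q}"
  using assms by (auto simp: words_def supp_def)

lemma saturated_codeI:
  assumes "C \<subseteq> words q w V"
    and "\<And>p a. p \<in> V \<Longrightarrow> a \<in> {1..<q} \<Longrightarrow> \<exists>f\<in>C. f p = a"
    and "\<And>f g p. f \<in> C \<Longrightarrow> g \<in> C \<Longrightarrow> p \<in> supp f \<Longrightarrow> f p = g p \<Longrightarrow> f = g"
    and "\<And>f g. f \<in> C \<Longrightarrow> g \<in> C \<Longrightarrow> f \<noteq> g \<Longrightarrow> card (supp f \<inter> supp g) \<le> 1"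
  shows "saturated_code q w V C"
proof -
  have "\<exists>!f. f \<in> C \<and> f p = a" if pa: "p \<in> V" "a \<in> {1..<q}" for p a
  proof (rule ex_ex1I)
    show "f = g" if "f \<in> C \<and> f p = a" "g \<in> C \<and> g p = a" for f g
      using assms(3)[of f g p] pa that by (auto simp: supp_def)
  qed (use assms(2) pa in blast)
  then show ?thesis
    using assms(1,4) by (simp add: saturated_code_def)
qed

lemma saturated_codeD:
  assumes "saturated_code q w V C"
  shows "C \<subseteq> words q w V" "f \<in> C \<Longrightarrow> f \<in> words q w V"
    "p \<in> V \<Longrightarrow> a \<in> {1..<q} \<Longrightarrow> \<exists>f\<in>C. f p = a"
    "f \<in> C \<Longrightarrow> g \<in> C \<Longrightarrow> p \<in> supp f \<Longrightarrow> f p = g p \<Longrightarrow> f = g"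
    "f \<in> C \<Longrightarrow> g \<in> C \<Longrightarrow> f \<noteq> g \<Longrightarrow> card (supp f \<inter> supp g) \<le> 1"
proof -
  show "C \<subseteq> words q w V"
    using assms by (simp add: saturated_code_def)
  then show word: "f \<in> words q w V" if "f \<in> C" for f
    using that by blast
  have ex1: "\<exists>!f. f \<in> C \<and> f p = a" if "p \<in> V" "a \<in> {1..<q}" for p a
    using assms that by (simp add: saturated_code_def)
  show "\<exists>f\<in>C. f p = a" if "p \<in> V" "a \<in> {1..<q}"
    using ex1[OF that] by blast
  show "f = g" if "f \<in> C" "g \<in> C" "p \<in> supp f" "f p = g p"
    using ex1[of p "f p"] wordsD(2,4)[OF word[OF that(1)]] that by (metis subsetD)
  show "card (supp f \<inter> supp g) \<le> 1" if "f \<in> C" "g \<in> C" "f \<noteq> g"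
    using assms that by (simp add: saturated_code_def)
qed

lemma tilingI:
  assumes "\<And>j. j \<in> J \<Longrightarrow> saturated_code q w V (C j)"
    and "\<And>f. f \<in> words q w V \<Longrightarrow> \<exists>j\<in>J. f \<in> C j"
    and "\<And>i j f. i \<in> J \<Longrightarrow> j \<in> J \<Longrightarrow> f \<in> C i \<Longrightarrow> f \<in> C j \<Longrightarrow> i = j"
  shows "tiling q w V J C"
  unfolding tiling_def using assms by metis

lemma tilingD:
  assumes "tiling q w V J C"
  shows "j \<in> J \<Longrightarrow> saturated_code q w V (C j)"
    "words q w V = (\<Union>j\<in>J. C j)"
    "i \<in> J \<Longrightarrow> j \<in> J \<Longrightarrow> f \<in> C i \<Longrightarrow> f \<in> C j \<Longrightarrow> i = j"
proof -
  show sat: "saturated_code q w V (C j)" if "j \<in> J" for j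
    using assms that by (simp add: tiling_def)
  have ex1: "\<exists>!j. j \<in> J \<and> f \<in> C j" if "f \<in> words q w V" for f
    using assms that by (simp add: tiling_def)
  show "words q w V = (\<Union>j\<in>J. C j)"
    using ex1 saturated_codeD(1)[OF sat] by fastforce
  show "i = j" if "i \<in> J" "j \<in> J" "f \<in> C i" "f \<in> C j"
    using ex1[of f] saturated_codeD(2)[OF sat] that by blast
qed

lemma words_mono: "V \<subseteq> V' \<Longrightarrow> words q w V \<subseteq> words q w V'"
  by (auto simp: words_def)

lemma finite_supp: "finite V \<Longrightarrow> f \<in> words q w V \<Longrightarrow> finite (supp f)"
  by (auto dest: wordsD(2) finite_subset)

lemma finite_words:
  assumes "finite V"
  shows "finite (words q w V)"
proof (rule finite_subset)
  show "words q w V \<subseteq> {f. \<forall>p. (p \<in> V \<longrightarrow> f p \<in> {..<q}) \<and> (p \<notin> V \<longrightarrow> f p = 0)}"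
    by (auto simp: words_def supp_def)
  show "finite {f. \<forall>p. (p \<in> V \<longrightarrow> f p \<in> {..<q}) \<and> (p \<notin> V \<longrightarrow> f p = 0)}"
    using assms by (rule finite_set_of_finite_funs) simp
qed

lemma card_words_of_supp:
  assumes "finite T" "T \<subseteq> V" "0 < q"
  shows "card {f \<in> words q (card T) V. supp f = T} = (q - 1) ^ card T"
proof -
  have "bij_betw (\<lambda>f. restrict f T) {f \<in> words q (card T) V. supp f = T} (T \<rightarrow>\<^sub>E {1..<q})"
    by (rule bij_betw_byWitness[where f' = "\<lambda>g p. if p \<in> T then g p else 0"])
      (use assms in \<open>auto simp: words_def supp_def fun_eq_iff Suc_le_eq PiE_iff extensional_def\<close>)
  then show ?thesis
    using assms(1) by (simp add: bij_betw_same_card card_PiE)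
qed

lemma card_words:
  assumes "finite V" "0 < q"
  shows "card (words q w V) = (card V choose w) * (q - 1) ^ w"
proof -
  let ?Ts = "{T. T \<subseteq> V \<and> card T = w}"
  have "finite ?Ts"
    using assms by simp
  have "words q w V = (\<Union>T\<in>?Ts. {f \<in> words q w V. supp f = T})"
    by (auto dest: wordsD)
  then have "card (words q w V) = (\<Sum>T\<in>?Ts. card {f \<in> words q w V. supp f = T})"
    using \<open>finite ?Ts\<close> finite_words[OF assms(1)]
    by (subst card_UN_disjoint[symmetric]) auto
  also have "\<dots> = (\<Sum>T\<in>?Ts. (q - 1) ^ w)"
    using assms by (intro sum.cong) (auto simp: card_words_of_supp finite_subset)
  finally show ?thesis
    using assms by (simp add: n_subsets)
qed

lemma card_saturated_code:
  assumes C: "saturated_code q w V C" and V: "finite V"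
  shows "w * card C = card V * (q - 1)"
proof -
  have word: "f p \<in> {1..<q}" "p \<in> V" if "f \<in> C" "p \<in> supp f" for f p
    using saturated_codeD(2)[OF C that(1)] that(2) wordsD[of f q w V] by blast+
  have "finite C"
    using saturated_codeD(1)[OF C] finite_words[OF V] by (rule finite_subset)
  moreover have "\<forall>f\<in>C. finite (supp f) \<and> card (supp f) = w"
    using saturated_codeD(2)[OF C] finite_supp[OF V] wordsD(3) by metis
  moreover have "bij_betw (\<lambda>(f, p). (p, f p)) (Sigma C supp) (V \<times> {1..<q})"
  proof (rule bij_betw_imageI)
    show "inj_on (\<lambda>(f, p). (p, f p)) (Sigma C supp)"
      using saturated_codeD(4)[OF C] by (auto simp: inj_on_def)
    show "(\<lambda>(f, p). (p, f p)) ` Sigma C supp = V \<times> {1..<q}"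
    proof
      show "V \<times> {1..<q} \<subseteq> (\<lambda>(f, p). (p, f p)) ` Sigma C supp"
      proof clarify
        fix p a assume pa: "p \<in> V" "a \<in> {1..<q}"
        then obtain f where "f \<in> C" "f p = a"
          using saturated_codeD(3)[OF C] by blast
        with pa show "(p, a) \<in> (\<lambda>(f, p). (p, f p)) ` Sigma C supp"
          by (intro image_eqI[of _ _ "(f, p)"]) (auto simp: supp_def)
      qed
    qed (use word in auto)
  qed
  then have "card (Sigma C supp) = card (V \<times> {1..<q})"
    by (rule bij_betw_same_card)
  ultimately show ?thesis
    by (simp add: card_SigmaI card_cartesian_product mult.commute)
qed

lemma saturated_code_distance:
  assumes C: "saturated_code q w V C" and V: "finite V" and f: "f \<in> C" and g: "g \<in> C"
    and "f \<noteq> g"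
  shows "2 * w - 1 \<le> card {p. f p \<noteq> g p}"
proof -
  have fg: "f \<in> words q w V" "g \<in> words q w V"
    using C f g by (auto simp: saturated_code_def)
  then have fin: "finite (supp f)" "finite (supp g)"
    using finite_supp[OF V] by blast+
  have "f p \<noteq> g p" if "p \<in> supp f" for p
    using saturated_codeD(4)[OF C f g that] \<open>f \<noteq> g\<close> by blast
  then have "{p. f p \<noteq> g p} = supp f \<union> supp g"
    by (force simp: supp_def)
  moreover have "card (supp f) + card (supp g) = card (supp f \<union> supp g) + card (supp f \<inter> supp g)"
    by (rule card_Un_Int[OF fin])
  moreover have "card (supp f \<inter> supp g) \<le> 1"
    using C f g \<open>f \<noteq> g\<close> by (simp add: saturated_code_def)
  ultimately show ?thesis
    using wordsD(3)[OF fg(1)] wordsD(3)[OF fg(2)] by simp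
qed

lemma finite_index_tiling:
  assumes tiling: "tiling q w V J C" and V: "finite V" "V \<noteq> {}" and "1 < q"
  shows "finite J"
proof -
  have "C j \<noteq> {}" if "j \<in> J" for j
    using V(2) \<open>1 < q\<close> saturated_codeD(3)[OF tilingD(1)[OF tiling that], of _ 1] by auto
  then have "inj_on C J"
    using tilingD(3)[OF tiling] by (intro inj_onI) (metis ex_in_conv)
  moreover have "C ` J \<subseteq> Pow (words q w V)"
    using tilingD(2)[OF tiling] by auto
  ultimately show ?thesis
    using finite_words[OF V(1)] by (meson finite_Pow_iff inj_on_finite)
qed

lemma card_index_tiling:
  assumes tiling: "tiling q w V J C" and V: "finite V" "V \<noteq> {}" and "0 < w" "1 < q"
  shows "card J = ((card V - 1) choose (w - 1)) * (q - 1) ^ (w - 1)"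
proof -
  note words = tilingD(2)[OF tiling]
  have "finite (C j)" if "j \<in> J" for j
    using that words finite_words[OF V(1)] by (metis UN_upper finite_subset)
  then have "w * card (words q w V) = (\<Sum>j\<in>J. w * card (C j))"
    unfolding words using finite_index_tiling[OF tiling V \<open>1 < q\<close>] tilingD(3)[OF tiling]
    by (subst card_UN_disjoint) (auto simp: sum_distrib_left)
  also have "\<dots> = card J * (card V * (q - 1))"
    using card_saturated_code[OF tilingD(1)[OF tiling] V(1)] by simp
  also have "w * card (words q w V) =
      ((card V - 1) choose (w - 1)) * (q - 1) ^ (w - 1) * (card V * (q - 1))"
    using times_binomial_minus1_eq[OF \<open>0 < w\<close>, of "card V"] \<open>0 < w\<close> \<open>1 < q\<close> V
    by (cases w) (simp_all add: card_words flip: mult.assoc)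
  moreover have "0 < card V * (q - 1)"
    using V \<open>1 < q\<close> by (simp add: card_gt_0_iff)
  ultimately show ?thesis
    by simp
qed

lemma tiling_reindex:
  assumes tiling: "tiling q w V J C" and e: "bij_betw e J' J"
  shows "tiling q w V J' (\<lambda>j. C (e j))"
proof (rule tilingI)
  show "saturated_code q w V (C (e j))" if "j \<in> J'" for j
    using tilingD(1)[OF tiling] bij_betwE[OF e] that by blast
  show "\<exists>j\<in>J'. f \<in> C (e j)" if "f \<in> words q w V" for f
    using tilingD(2)[OF tiling] bij_betw_imp_surj_on[OF e] that by blast
  show "i = j" if "i \<in> J'" "j \<in> J'" "f \<in> C (e i)" "f \<in> C (e j)" for i j f
    using tilingD(3)[OF tiling] bij_betwE[OF e] bij_betw_imp_inj_on[OF e] that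
    by (meson inj_onD)
qed

section \<open>Transport to other point sets\<close>

definition pullback :: "('b \<Rightarrow> 'a) \<Rightarrow> 'b set \<Rightarrow> ('a \<Rightarrow> nat) \<Rightarrow> 'b \<Rightarrow> nat" where
  "pullback h V' f = (\<lambda>p. if p \<in> V' then f (h p) else 0)"

lemma supp_pullback: "supp (pullback h V' f) = {p \<in> V'. h p \<in> supp f}"
  by (auto simp: supp_def pullback_def)

lemma card_supp_pullback:
  assumes "bij_betw h V' V" "A \<subseteq> V"
  shows "card {p \<in> V'. h p \<in> A} = card A"
proof (rule bij_betw_same_card)
  show "bij_betw h {p \<in> V'. h p \<in> A} A"
    using assms unfolding bij_betw_def inj_on_def by auto
qed

lemma pullback_words:
  assumes "bij_betw h V' V" "f \<in> words q w V"
  shows "pullback h V' f \<in> words q w V'"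
proof -
  have "pullback h V' f p < q" for p
    using wordsD(1)[OF assms(2), of "h p"] by (auto simp: pullback_def)
  then show ?thesis
    using assms card_supp_pullback[OF assms(1)]
    by (auto simp: words_def supp_pullback)
qed

lemma bij_betw_pullback:
  assumes h: "bij_betw h V' V"
  shows "bij_betw (pullback h V') (words q w V) (words q w V')"
proof (rule bij_betw_byWitness)
  let ?h' = "the_inv_into V' h"
  have h': "bij_betw ?h' V V'"
    by (rule bij_betw_the_inv_into[OF h])
  have inv: "?h' (h p) = p" "h p \<in> V" if "p \<in> V'" for p
    using h that by (auto simp: the_inv_into_f_f bij_betw_def)
  have inv': "h (?h' p) = p" "?h' p \<in> V'" if "p \<in> V" for p
    using h that f_the_inv_into_f_bij_betw[OF h] bij_betwE[OF h'] by auto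
  show "\<forall>f\<in>words q w V. pullback ?h' V (pullback h V' f) = f"
    using inv' by (force simp: pullback_def words_def supp_def fun_eq_iff)
  show "\<forall>f\<in>words q w V'. pullback h V' (pullback ?h' V f) = f"
    using inv by (force simp: pullback_def words_def supp_def fun_eq_iff)
  show "pullback h V' ` words q w V \<subseteq> words q w V'"
    using pullback_words[OF h] by blast
  show "pullback ?h' V ` words q w V' \<subseteq> words q w V"
    using pullback_words[OF h'] by blast
qed

lemma saturated_code_pullback:
  assumes h: "bij_betw h V' V" and C: "saturated_code q w V C"
  shows "saturated_code q w V' (pullback h V' ` C)"
proof (rule saturated_codeI)
  show "pullback h V' ` C \<subseteq> words q w V'"
    using saturated_codeD(1)[OF C] pullback_words[OF h] by blast
  have h_in: "h p \<in> V" if "p \<in> V'" for p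
    using bij_betwE[OF h] that by blast
  show "\<exists>f'\<in>pullback h V' ` C. f' p = a" if "p \<in> V'" "a \<in> {1..<q}" for p a
    using saturated_codeD(3)[OF C h_in[OF that(1)] that(2)] that(1) by (auto simp: pullback_def)
  fix f' g' assume "f' \<in> pullback h V' ` C" "g' \<in> pullback h V' ` C"
  then obtain f g where fg: "f \<in> C" "g \<in> C"
    and f': "f' = pullback h V' f" and g': "g' = pullback h V' g"
    by auto
  show "f' = g'" if "p \<in> supp f'" "f' p = g' p" for p
    using saturated_codeD(4)[OF C fg, of "h p"] that
    by (auto simp: f' g' supp_pullback) (simp add: pullback_def)
  assume "f' \<noteq> g'"
  then have "card (supp f \<inter> supp g) \<le> 1"
    using saturated_codeD(5)[OF C fg] f' g' by blast
  moreover have "supp f' \<inter> supp g' = {p \<in> V'. h p \<in> supp f \<inter> supp g}"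
    by (auto simp: f' g' supp_pullback)
  moreover have "supp f \<inter> supp g \<subseteq> V"
    using wordsD(2)[OF saturated_codeD(2)[OF C fg(1)]] by blast
  ultimately show "card (supp f' \<inter> supp g') \<le> 1"
    by (simp only: card_supp_pullback[OF h])
qed

lemma tiling_pullback:
  assumes h: "bij_betw h V' V" and tiling: "tiling q w V J C"
  shows "tiling q w V' J (\<lambda>j. pullback h V' ` C j)"
proof (rule tilingI)
  note bij = bij_betw_pullback[OF h, of q w]
  show "saturated_code q w V' (pullback h V' ` C j)" if "j \<in> J" for j
    using tilingD(1)[OF tiling that] by (rule saturated_code_pullback[OF h])
  show "\<exists>j\<in>J. f' \<in> pullback h V' ` C j" if "f' \<in> words q w V'" for f'
  proof -
    have "f' \<in> pullback h V' ` words q w V"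
      using that by (simp add: bij_betw_imp_surj_on[OF bij])
    then show ?thesis
      by (auto simp: tilingD(2)[OF tiling])
  qed
  show "i = j" if ij: "i \<in> J" "j \<in> J" "f' \<in> pullback h V' ` C i" "f' \<in> pullback h V' ` C j"
    for i j f'
  proof -
    obtain f g where fg: "f \<in> C i" "g \<in> C j" "pullback h V' f = pullback h V' g"
      using ij(3,4) by auto
    then have "f = g"
      using ij(1,2) tilingD(2)[OF tiling] by (intro inj_onD[OF bij_betw_imp_inj_on[OF bij]]) auto
    then show ?thesis
      using tilingD(3)[OF tiling] ij(1,2) fg(1,2) by blast
  qed
qed

definition tileable :: "nat \<Rightarrow> nat \<Rightarrow> 'a set \<Rightarrow> bool" where
  "tileable q w V \<longleftrightarrow> (\<exists>(J :: nat set) C. tiling q w V J C)"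

lemma tiling_imp_tileable:
  assumes tiling: "tiling q w V J C" and "finite V" "V \<noteq> {}" "1 < q"
  shows "tileable q w V"
proof -
  obtain e :: "nat \<Rightarrow> 'b" where "bij_betw e {0..<card J} J"
    using ex_bij_betw_nat_finite[OF finite_index_tiling[OF assms]] by blast
  then show ?thesis
    using tiling_reindex[OF tiling] unfolding tileable_def by blast
qed

lemma tileable_imp_tiling:
  assumes "tileable q w V" and V: "finite V" "V \<noteq> {}" and "0 < w" "1 < q"
    and V': "finite V'" "card V' = card V"
    and J': "finite J'" "card J' = ((card V - 1) choose (w - 1)) * (q - 1) ^ (w - 1)"
  shows "\<exists>C. tiling q w V' J' C"
proof -
  obtain J :: "nat set" and C where tiling: "tiling q w V J C"
    using assms(1) by (auto simp: tileable_def)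
  obtain h where "bij_betw h V' V"
    using V' V(1) finite_same_card_bij by blast
  note tiling' = tiling_pullback[OF this tiling]
  have "card J' = card J"
    using card_index_tiling[OF tiling V \<open>0 < w\<close> \<open>1 < q\<close>] J'(2) by simp
  then obtain e where "bij_betw e J' J"
    using J'(1) finite_index_tiling[OF tiling V \<open>1 < q\<close>] finite_same_card_bij by blast
  then show ?thesis
    using tiling_reindex[OF tiling'] by blast
qed

section \<open>Optimality\<close>

lemma finite_Hq: "finite (Hq q n w)"
  by (rule finite_subset[OF _ finite_lists_length_eq[of "{0..<q}" n]]) (auto simp: Hq_def)

lemma bij_betw_words_Hq:
  assumes "0 < q"
  shows "bij_betw (\<lambda>f. map f [0..<n]) (words q w {..<n}) (Hq q n w)"
proof (rule bij_betw_byWitness[where f' = "\<lambda>x i. if i < n then x ! i else 0"])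
  show "(\<lambda>f. map f [0..<n]) ` words q w {..<n} \<subseteq> Hq q n w"
  proof clarify
    fix f assume f: "f \<in> words q w {..<n}"
    then have "{i. i < n \<and> map f [0..<n] ! i \<noteq> 0} = supp f"
      by (auto simp: words_def supp_def)
    with f show "map f [0..<n] \<in> Hq q n w"
      by (auto simp: Hq_def weight_def words_def)
  qed
  show "(\<lambda>x i. if i < n then x ! i else 0) ` Hq q n w \<subseteq> words q w {..<n}"
  proof clarify
    fix x assume x: "x \<in> Hq q n w"
    let ?f = "\<lambda>i. if i < n then x ! i else 0"
    have "supp ?f = {i. i < n \<and> x ! i \<noteq> 0}"
      by (auto simp: supp_def)
    moreover have "?f i < q" for i
      using x nth_mem[of i x] assms by (force simp: Hq_def)
    ultimately show "?f \<in> words q w {..<n}"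
      using x by (auto simp: Hq_def weight_def words_def)
  qed
qed (auto simp: words_def supp_def Hq_def fun_eq_iff intro: nth_equalityI)

lemma hamming_dist_words:
  assumes "f \<in> words q w {..<n}" "g \<in> words q w {..<n}"
  shows "hamming_dist (map f [0..<n]) (map g [0..<n]) = card {i. f i \<noteq> g i}"
proof -
  have "i < n" if "f i \<noteq> g i" for i
    using wordsD(2)[OF assms(1)] wordsD(2)[OF assms(2)] that
    by (cases "f i = 0") (auto simp: supp_def subset_iff)
  then have "{i. i < n \<and> map f [0..<n] ! i \<noteq> map g [0..<n] ! i} = {i. f i \<noteq> g i}"
    by auto
  then show ?thesis
    by (simp add: hamming_dist_def)
qed

lemma code_eqI:
  assumes C: "is_code q n (2 * w - 1) w C" and x: "x \<in> C" and y: "y \<in> C"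
    and i: "i < n" "x ! i \<noteq> 0" "x ! i = y ! i"
  shows "x = y"
proof (rule ccontr)
  define S where "S z = {j. j < n \<and> z ! j \<noteq> 0}" for z :: "nat list"
  have len: "length x = n"
    and S: "card (S x) = w" "card (S y) = w" "i \<in> S x" "i \<in> S y" "finite (S z)" for z
    using C x y i by (auto simp: is_code_def Hq_def weight_def S_def)
  assume "x \<noteq> y"
  then have "2 * w - 1 \<le> hamming_dist x y"
    using C x y by (simp add: is_code_def)
  also have "\<dots> \<le> card ((S x - {i}) \<union> (S y - {i}))"
    unfolding hamming_dist_def using len i(3) S(5) by (intro card_mono) (auto simp: S_def)
  also have "\<dots> \<le> card (S x - {i}) + card (S y - {i})"
    by (rule card_Un_le)
  also have "\<dots> = 2 * (w - 1)"
    using S by simp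
  moreover have "0 < w"
    using S(1,3,5) by (metis card_gt_0_iff empty_iff)
  ultimately show False
    by simp
qed

lemma card_code_le:
  assumes C: "is_code q n (2 * w - 1) w C"
  shows "w * card C \<le> n * (q - 1)"
proof -
  define S where "S x = {i. i < n \<and> x ! i \<noteq> 0}" for x :: "nat list"
  have x: "length x = n" "set x \<subseteq> {0..<q}" "card (S x) = w" if "x \<in> C" for x
    using C that by (auto simp: is_code_def Hq_def weight_def S_def)
  have "inj_on (\<lambda>(x, i). (i, x ! i)) (Sigma C S)"
    using code_eqI[OF C] by (auto simp: inj_on_def S_def)
  then have "card (Sigma C S) = card ((\<lambda>(x, i). (i, x ! i)) ` Sigma C S)"
    by (simp add: card_image)
  also have "\<dots> \<le> card ({..<n} \<times> {1..<q})"
    using x(1,2) by (intro card_mono) (auto simp: S_def Suc_le_eq subset_iff dest!: nth_mem)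
  finally show ?thesis
    using finite_subset[OF _ finite_Hq] C x(3)
    by (auto simp: is_code_def card_SigmaI S_def mult.commute)
qed

lemma optimal_codeI:
  assumes C: "is_code q n (2 * w - 1) w C" "w * card C = n * (q - 1)" and "0 < w"
  shows "optimal_code q n (2 * w - 1) w C"
proof -
  have "card C = Max (card ` {C. is_code q n (2 * w - 1) w C})"
  proof (rule Max_eqI[symmetric])
    have "{C. is_code q n (2 * w - 1) w C} \<subseteq> Pow (Hq q n w)"
      by (auto simp: is_code_def)
    then show "finite (card ` {C. is_code q n (2 * w - 1) w C})"
      by (meson finite_Hq finite_Pow_iff finite_imageI finite_subset)
  next
    fix m assume "m \<in> card ` {C. is_code q n (2 * w - 1) w C}"
    then obtain D where "is_code q n (2 * w - 1) w D" "m = card D" by auto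
    with card_code_le[of q n w D] C(2) \<open>0 < w\<close> show "m \<le> card C"
      by (metis mult_le_cancel1)
  qed (use C in auto)
  then show ?thesis
    using C by (simp add: optimal_code_def Aq_def)
qed

lemma saturated_code_imp_optimal_code:
  assumes C: "saturated_code q w {..<n} C" and "0 < n" "1 < q"
  shows "optimal_code q n (2 * w - 1) w ((\<lambda>f. map f [0..<n]) ` C)"
    (is "optimal_code _ _ _ _ (?list ` C)")
proof (rule optimal_codeI)
  have card: "w * card C = n * (q - 1)"
    using card_saturated_code[OF C] by simp
  moreover have "0 < n * (q - 1)"
    using \<open>0 < n\<close> \<open>1 < q\<close> by simp
  ultimately have "0 < w" "C \<noteq> {}"
    by (auto intro: Nat.gr0I)
  then show "0 < w" by simp
  have sub: "C \<subseteq> words q w {..<n}"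
    using C by (simp add: saturated_code_def)
  have bij: "bij_betw ?list (words q w {..<n}) (Hq q n w)"
    using \<open>1 < q\<close> by (simp add: bij_betw_words_Hq)
  have "inj_on ?list C"
    using bij_betw_imp_inj_on[OF bij] sub by (rule inj_on_subset)
  then show "w * card (?list ` C) = n * (q - 1)"
    using card by (simp add: card_image)
  have "2 * w - 1 \<le> hamming_dist (?list f) (?list g)"
    if fg: "f \<in> C" "g \<in> C" "?list f \<noteq> ?list g" for f g
  proof -
    have "hamming_dist (?list f) (?list g) = card {i. f i \<noteq> g i}"
      using saturated_codeD(2)[OF C] fg(1,2) by (intro hamming_dist_words) blast+
    moreover have "f \<noteq> g"
      using fg(3) by blast
    ultimately show ?thesis
      using saturated_code_distance[OF C _ fg(1,2)] by simp
  qed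
  moreover have "?list ` C \<subseteq> Hq q n w"
    using sub bij_betw_imp_surj_on[OF bij] by auto
  ultimately show "is_code q n (2 * w - 1) w (?list ` C)"
    using \<open>C \<noteq> {}\<close> by (auto simp: is_code_def)
qed

lemma tileable_imp_TOC:
  assumes "tileable q w V" and V: "finite V" "V \<noteq> {}" and "1 < q"
  shows "\<exists>P. is_TOC q (card V) (2 * w - 1) w P"
proof -
  define n where "n = card V"
  have "0 < n"
    using V by (simp add: n_def card_gt_0_iff)
  obtain h where "bij_betw h {..<n} V"
    using ex_bij_betw_nat_finite[OF V(1)] by (auto simp: n_def atLeast0LessThan)
  with assms(1) obtain J :: "nat set" and C where tiling: "tiling q w {..<n} J C"
    using tiling_pullback unfolding tileable_def by blast
  let ?list = "\<lambda>f. map f [0..<n]"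
  let ?P = "(\<lambda>j. ?list ` C j) ` J"
  have bij: "bij_betw ?list (\<Union>j\<in>J. C j) (Hq q n w)"
    using bij_betw_words_Hq[of q n w] \<open>1 < q\<close> by (simp add: tilingD(2)[OF tiling])
  have "A \<inter> B = {}" if AB: "A \<in> ?P" "B \<in> ?P" "A \<noteq> B" for A B
  proof -
    obtain i j where ij: "i \<in> J" "j \<in> J" "i \<noteq> j" "A = ?list ` C i" "B = ?list ` C j"
      using AB by blast
    then have "C i \<inter> C j = {}"
      using tilingD(3)[OF tiling] by blast
    then show ?thesis
      using ij inj_on_image_Int[OF bij_betw_imp_inj_on[OF bij], of "C i" "C j"] by auto
  qed
  moreover have "\<Union>?P = Hq q n w"
    by (simp add: image_UN flip: bij_betw_imp_surj_on[OF bij])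
  moreover have "\<forall>A\<in>?P. optimal_code q n (2 * w - 1) w A"
    using tilingD(1)[OF tiling] saturated_code_imp_optimal_code[OF _ \<open>0 < n\<close> \<open>1 < q\<close>] by blast
  ultimately have "is_TOC q n (2 * w - 1) w ?P"
    by (simp add: is_TOC_def)
  then show ?thesis
    unfolding n_def by blast
qed

section \<open>Resolutions of Steiner systems\<close>

lemma saturated_code_UN:
  assumes part: "partition_on V P" and C: "\<And>B. B \<in> P \<Longrightarrow> saturated_code q w B (C B)"
  shows "saturated_code q w V (\<Union>B\<in>P. C B)"
proof (rule saturated_codeI)
  have supp: "supp f \<subseteq> B" if "B \<in> P" "f \<in> C B" for f B
    using wordsD(2) saturated_codeD(2)[OF C] that by metis
  show "(\<Union>B\<in>P. C B) \<subseteq> words q w V"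
  proof (rule UN_least)
    fix B assume "B \<in> P"
    then show "C B \<subseteq> words q w V"
      using saturated_codeD(1)[OF C] words_mono[of B V] partition_onD1[OF part] by blast
  qed
  show "\<exists>f\<in>(\<Union>B\<in>P. C B). f p = a" if p: "p \<in> V" and a: "a \<in> {1..<q}" for p a
  proof -
    obtain B where "B \<in> P" "p \<in> B"
      using p partition_onD1[OF part] by blast
    then show ?thesis
      using saturated_codeD(3)[OF C _ a] by blast
  qed
  fix f g assume "f \<in> (\<Union>B\<in>P. C B)" "g \<in> (\<Union>B\<in>P. C B)"
  then obtain B D where B: "B \<in> P" "f \<in> C B" and D: "D \<in> P" "g \<in> C D"
    by blast
  have disj: "B = D \<or> supp f \<inter> supp g = {}"
    using supp[OF B] supp[OF D] disjointD[OF partition_onD2[OF part] B(1) D(1)] by auto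
  show "f = g" if p: "p \<in> supp f" "f p = g p" for p
  proof -
    have "p \<in> supp g"
      using p by (simp add: supp_def)
    then have "B = D"
      using disj p(1) by blast
    then show ?thesis
      using saturated_codeD(4)[OF C] B D p by blast
  qed
  show "card (supp f \<inter> supp g) \<le> 1" if "f \<noteq> g"
    using disj saturated_codeD(5)[OF C[OF B(1)]] B D that by fastforce
qed

locale multiresolution =
  fixes V :: "'a set" and w k l :: nat and I :: "'i set" and cls :: "'i \<Rightarrow> 'a set set"
  assumes finite_points: "finite V" and finite_index: "finite I"
    and partition_on_cls: "i \<in> I \<Longrightarrow> partition_on V (cls i)"
    and card_block: "i \<in> I \<Longrightarrow> B \<in> cls i \<Longrightarrow> card B = k"
    and card_index_of_block: "i \<in> I \<Longrightarrow> B \<in> cls i \<Longrightarrow> card {j \<in> I. B \<in> cls j} = l"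
    and ex_block: "T \<subseteq> V \<Longrightarrow> card T = w \<Longrightarrow> \<exists>i\<in>I. \<exists>B\<in>cls i. T \<subseteq> B"
    and block_unique: "i \<in> I \<Longrightarrow> j \<in> I \<Longrightarrow> B \<in> cls i \<Longrightarrow> D \<in> cls j \<Longrightarrow>
      T \<subseteq> B \<inter> D \<Longrightarrow> card T = w \<Longrightarrow> B = D"
begin

text \<open>The codes on a block are shared out among the classes containing it; that a block occurs in
  several classes therefore does no harm.\<close>

lemma tiling_merge:
  assumes tiling: "\<And>i B. i \<in> I \<Longrightarrow> B \<in> cls i \<Longrightarrow> tiling q w B ({j \<in> I. B \<in> cls j} \<times> M) (E B)"
  shows "tiling q w V (I \<times> M) (\<lambda>(i, m). \<Union>B\<in>cls i. E B (i, m))" (is "tiling _ _ _ _ ?C")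
proof (rule tilingI)
  have sat: "saturated_code q w B (E B (i, m))" if "i \<in> I" "m \<in> M" "B \<in> cls i" for i m B
    using tilingD(1)[OF tiling, of i B "(i, m)"] that by blast
  show "saturated_code q w V (?C x)" if "x \<in> I \<times> M" for x
    using that sat saturated_code_UN[OF partition_on_cls] by auto
  show "\<exists>x\<in>I \<times> M. f \<in> ?C x" if f: "f \<in> words q w V" for f
  proof -
    obtain i B where B: "i \<in> I" "B \<in> cls i" "supp f \<subseteq> B"
      using ex_block[OF wordsD(2,3)[OF f]] by blast
    then have "f \<in> words q w B"
      using f by (simp add: words_def)
    then obtain j m where "j \<in> I" "B \<in> cls j" "m \<in> M" "f \<in> E B (j, m)"
      using tilingD(2)[OF tiling[OF B(1,2)]] by auto
    then show ?thesis
      by (intro bexI[of _ "(j, m)"]) auto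
  qed
  fix x y f assume "x \<in> I \<times> M" "y \<in> I \<times> M" "f \<in> ?C x" "f \<in> ?C y"
  then obtain i m B j n D where x: "x = (i, m)" "i \<in> I" "m \<in> M" "B \<in> cls i" "f \<in> E B (i, m)"
    and y: "y = (j, n)" "j \<in> I" "n \<in> M" "D \<in> cls j" "f \<in> E D (j, n)"
    by auto
  have "f \<in> words q w B" "f \<in> words q w D"
    using saturated_codeD(2)[OF sat] x y by blast+
  then have "B = D"
    using block_unique[OF x(2) y(2) x(4) y(4), of "supp f"] wordsD(2,3) by blast
  then show "x = y"
    using tilingD(3)[OF tiling[OF x(2,4)], of x y f] x y by simp
qed

lemma tileable_of_block:
  assumes block: "tileable q w {..<k}"
    and V: "V \<noteq> {}" and "0 < w" "1 < q"
    and dvd: "l dvd ((k - 1) choose (w - 1)) * (q - 1) ^ (w - 1)"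
  shows "tileable q w V"
proof -
  obtain m where m: "((k - 1) choose (w - 1)) * (q - 1) ^ (w - 1) = l * m"
    using dvd by blast
  have "\<exists>E. tiling q w B ({j \<in> I. B \<in> cls j} \<times> {..<m}) E" if B: "i \<in> I" "B \<in> cls i" for i B
  proof -
    have "B \<subseteq> V" "B \<noteq> {}"
      using B(2) partition_onD1[OF partition_on_cls[OF B(1)]]
        partition_onD3[OF partition_on_cls[OF B(1)]] by auto
    then have "finite B"
      using finite_points by (blast intro: finite_subset)
    then have "0 < k"
      using \<open>B \<noteq> {}\<close> card_block[OF B] by auto
    show ?thesis
    proof (rule tileable_imp_tiling[OF block])
      show "finite ({j \<in> I. B \<in> cls j} \<times> {..<m})"
        using finite_index by simp
      show "card ({j \<in> I. B \<in> cls j} \<times> {..<m}) =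
          ((card {..<k} - 1) choose (w - 1)) * (q - 1) ^ (w - 1)"
        using m card_index_of_block[OF B] by (simp add: card_cartesian_product)
    qed (use \<open>finite B\<close> \<open>0 < k\<close> \<open>0 < w\<close> \<open>1 < q\<close> card_block[OF B] in
        \<open>auto simp: lessThan_empty_iff\<close>)
  qed
  then have "\<forall>B\<in>(\<Union>i\<in>I. cls i). \<exists>E. tiling q w B ({j \<in> I. B \<in> cls j} \<times> {..<m}) E"
    by blast
  from bchoice[OF this] obtain E where
    "\<forall>B\<in>(\<Union>i\<in>I. cls i). tiling q w B ({j \<in> I. B \<in> cls j} \<times> {..<m}) (E B)" ..
  then have "tiling q w V (I \<times> {..<m}) (\<lambda>(i, m). \<Union>B\<in>cls i. E B (i, m))"
    by (intro tiling_merge) blast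
  then show ?thesis
    using finite_points V \<open>1 < q\<close> by (rule tiling_imp_tileable)
qed

end

section \<open>Rainbow configurations\<close>

lemma add_mod_left_cancel:
  fixes m r x y :: nat
  assumes "x < m" "y < m"
  shows "(r + x) mod m = (r + y) mod m \<longleftrightarrow> x = y"
  using assms cong_add_lcancel_nat[of r x y m] by (simp add: cong_def)

lemma ex_add_mod_eq:
  fixes a m r :: nat
  assumes "a < m"
  shows "\<exists>x<m. (r + x) mod m = a"
proof (intro exI conjI)
  have "(r + (a + (m - r mod m)) mod m) mod m = (r mod m + (a + (m - r mod m))) mod m"
    by (simp add: mod_simps)
  also have "r mod m + (a + (m - r mod m)) = a + m"
    using assms mod_less_divisor[of m r] by linarith
  finally show "(r + (a + (m - r mod m)) mod m) mod m = a"
    using assms by simp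
qed (use assms in simp)

definition zero_sum :: "nat \<Rightarrow> nat \<Rightarrow> (nat \<Rightarrow> nat) set" where
  "zero_sum w m = {t \<in> {..w} \<rightarrow>\<^sub>E {..<m}. m dvd (\<Sum>c\<le>w. t c)}"

lemma ex1_zero_sum_extension:
  assumes D: "D \<subseteq> {..w}" "card D = w" and r: "r \<in> D \<rightarrow> {..<m}" and "0 < m"
  shows "\<exists>!t. t \<in> zero_sum w m \<and> (\<forall>c\<in>D. t c = r c)"
proof -
  have fin: "finite D"
    using D(1) finite_subset by blast
  then have "card ({..w} - D) = 1"
    using D by (simp add: card_Diff_subset)
  then obtain c\<^sub>0 where "{..w} - D = {c\<^sub>0}"
    by (auto simp: card_1_singleton_iff)
  then have colours: "{..w} = insert c\<^sub>0 D" and c\<^sub>0: "c\<^sub>0 \<notin> D"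
    using D(1) by auto
  have zero_sum_iff: "t \<in> zero_sum w m \<longleftrightarrow>
      t \<in> insert c\<^sub>0 D \<rightarrow>\<^sub>E {..<m} \<and> (sum t D + t c\<^sub>0) mod m = 0" for t
    using fin c\<^sub>0 by (simp add: zero_sum_def colours dvd_eq_mod_eq_0 add.commute)
  obtain x where x: "x < m" "(sum r D + x) mod m = 0"
    using ex_add_mod_eq[OF \<open>0 < m\<close>, of "sum r D"] by metis
  show ?thesis
  proof (rule ex1I)
    let ?t = "\<lambda>c. if c = c\<^sub>0 then x else if c \<in> D then r c else undefined"
    have "sum ?t D = sum r D"
      using c\<^sub>0 by (intro sum.cong) auto
    then show "?t \<in> zero_sum w m \<and> (\<forall>c\<in>D. ?t c = r c)"
      using x r c\<^sub>0 by (auto simp: zero_sum_iff split: if_splits)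
    fix t assume t: "t \<in> zero_sum w m \<and> (\<forall>c\<in>D. t c = r c)"
    then have "t c\<^sub>0 < m" "(sum r D + t c\<^sub>0) mod m = 0"
      by (auto simp: zero_sum_iff)
    then have "t c\<^sub>0 = x"
      using x add_mod_left_cancel by metis
    with t show "t = ?t"
      by (auto simp: zero_sum_iff PiE_iff extensional_def fun_eq_iff)
  qed
qed

text \<open>
  A zero-sum vector \<open>t\<close> on the colours turns a block into the word with symbol \<open>1 + (t c + s) mod m\<close>
  at each point of the block, where \<open>c\<close> is the colour of the point and \<open>s\<close> numbers the \<open>m\<close> blocks
  through it. For fixed \<open>t\<close> these words form a saturated code. As any \<open>w\<close> of the \<open>w + 1\<close> entries of
  \<open>t\<close> can be prescribed and determine the remaining one, each word supported by a block arises from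
  exactly one \<open>t\<close>.
\<close>

locale rainbow_configuration =
  fixes w m :: nat and V :: "'a set" and \<B> :: "'a set set" and colour :: "'a \<Rightarrow> nat"
  assumes finite_points: "finite V" and degree_pos: "0 < m"
    and block_subset: "B \<in> \<B> \<Longrightarrow> B \<subseteq> V" and card_block: "B \<in> \<B> \<Longrightarrow> card B = w"
    and card_Int_le_1: "B \<in> \<B> \<Longrightarrow> D \<in> \<B> \<Longrightarrow> B \<noteq> D \<Longrightarrow> card (B \<inter> D) \<le> 1"
    and degree: "p \<in> V \<Longrightarrow> card {B \<in> \<B>. p \<in> B} = m"
    and colour_le: "p \<in> V \<Longrightarrow> colour p \<le> w" and rainbow: "B \<in> \<B> \<Longrightarrow> inj_on colour B"
begin

definition shift :: "'a \<Rightarrow> 'a set \<Rightarrow> nat" where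
  "shift p = (SOME e. bij_betw e {B \<in> \<B>. p \<in> B} {..<m})"

definition word :: "(nat \<Rightarrow> nat) \<Rightarrow> 'a set \<Rightarrow> 'a \<Rightarrow> nat" where
  "word t B p = (if p \<in> B then Suc ((t (colour p) + shift p B) mod m) else 0)"

definition code :: "(nat \<Rightarrow> nat) \<Rightarrow> ('a \<Rightarrow> nat) set" where
  "code t = word t ` \<B>"

lemma bij_betw_shift:
  assumes "p \<in> V"
  shows "bij_betw (shift p) {B \<in> \<B>. p \<in> B} {..<m}"
proof -
  have "\<exists>e. bij_betw e {B \<in> \<B>. p \<in> B} {..<m}"
    using degree[OF assms] degree_pos by (intro finite_same_card_bij) (auto intro: card_ge_0_finite)
  then show ?thesis
    unfolding shift_def by (rule someI_ex)
qed

lemma blocks_nonempty: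
  assumes "V \<noteq> {}"
  shows "\<B> \<noteq> {}"
proof
  assume "\<B> = {}"
  then have "card {B \<in> \<B>. p \<in> B} = 0" for p
    by simp
  then show False
    using assms degree degree_pos by fastforce
qed

lemma supp_word [simp]: "supp (word t B) = B"
  by (auto simp: supp_def word_def)

lemma word_in_words:
  assumes "B \<in> \<B>"
  shows "word t B \<in> words (Suc m) w V"
  using card_block[OF assms] block_subset[OF assms] degree_pos
  by (auto simp: words_def) (simp add: word_def)

lemma code_subset_words: "code t \<subseteq> words (Suc m) w V"
  using word_in_words by (auto simp: code_def)

lemma supp_code: "f \<in> code t \<Longrightarrow> supp f \<in> \<B>"
  by (auto simp: code_def)

lemma saturated_code_code: "saturated_code (Suc m) w V (code t)"
proof (rule saturated_codeI)
  show "code t \<subseteq> words (Suc m) w V"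
    by (rule code_subset_words)
  show "\<exists>f\<in>code t. f p = a" if p: "p \<in> V" and a: "a \<in> {1..<Suc m}" for p a
  proof -
    have "a - 1 < m"
      using a by auto
    then obtain s where s: "s < m" "(t (colour p) + s) mod m = a - 1"
      using ex_add_mod_eq by blast
    moreover have "s \<in> shift p ` {B \<in> \<B>. p \<in> B}"
      using s(1) by (simp add: bij_betw_imp_surj_on[OF bij_betw_shift[OF p]])
    then obtain B where "B \<in> \<B>" "p \<in> B" "s = shift p B"
      by blast
    ultimately show ?thesis
      using a by (auto simp: code_def word_def intro!: bexI[of _ B])
  qed
  fix f g assume "f \<in> code t" "g \<in> code t"
  then obtain B D where B: "B \<in> \<B>" "f = word t B" and D: "D \<in> \<B>" "g = word t D"
    by (auto simp: code_def)
  show "f = g" if "p \<in> supp f" "f p = g p" for p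
  proof -
    have p: "p \<in> B" "p \<in> D" "p \<in> V"
      using that B D block_subset by (auto simp: word_def split: if_splits)
    note bij = bij_betw_shift[OF p(3)]
    have "shift p B < m" "shift p D < m"
      using bij_betwE[OF bij] B(1) D(1) p by auto
    moreover have "(t (colour p) + shift p B) mod m = (t (colour p) + shift p D) mod m"
      using that(2) p by (simp add: B D word_def)
    ultimately have "shift p B = shift p D"
      by (simp add: add_mod_left_cancel)
    then have "B = D"
      using inj_onD[OF bij_betw_imp_inj_on[OF bij]] B(1) D(1) p by auto
    then show ?thesis
      by (simp add: B D)
  qed
  show "card (supp f \<inter> supp g) \<le> 1" if "f \<noteq> g"
    using card_Int_le_1 that B D by auto
qed

lemma in_code_iff:
  assumes "supp f \<in> \<B>"
  shows "f \<in> code t \<longleftrightarrow>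
    (\<forall>p\<in>supp f. (shift p (supp f) + t (colour p)) mod m = f p - 1)"
proof -
  have "f \<in> code t \<longleftrightarrow> f = word t (supp f)"
    using assms by (auto simp: code_def)
  also have "\<dots> \<longleftrightarrow> (\<forall>p\<in>supp f. f p = Suc ((shift p (supp f) + t (colour p)) mod m))"
    by (auto simp: fun_eq_iff word_def supp_def add.commute)
  also have "\<dots> \<longleftrightarrow> (\<forall>p\<in>supp f. (shift p (supp f) + t (colour p)) mod m = f p - 1)"
    by (rule ball_cong) (auto simp: supp_def)
  finally show ?thesis .
qed

lemma ex1_zero_sum_code:
  assumes f: "f \<in> words (Suc m) w V" and supp: "supp f \<in> \<B>"
  shows "\<exists>!t. t \<in> zero_sum w m \<and> f \<in> code t"
proof -
  define B where "B = supp f"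
  have B: "B \<in> \<B>" "B \<subseteq> V" and inj: "inj_on colour B"
    using supp block_subset rainbow by (auto simp: B_def)
  have "\<exists>x<m. (shift p B + x) mod m = f p - 1" if "p \<in> B" for p
    using wordsD(4)[OF f, of p] that by (intro ex_add_mod_eq) (auto simp: B_def)
  then obtain x where x: "\<And>p. p \<in> B \<Longrightarrow> x p < m"
      "\<And>p. p \<in> B \<Longrightarrow> (shift p B + x p) mod m = f p - 1"
    by metis
  define r where "r c = x (the_inv_into B colour c)" for c
  have r: "r (colour p) = x p" if "p \<in> B" for p
    using that inj by (simp add: r_def the_inv_into_f_f)
  have "f \<in> code t \<longleftrightarrow> (\<forall>c\<in>colour ` B. t c = r c)" if t: "t \<in> zero_sum w m" for t
  proof -
    have "(shift p B + t (colour p)) mod m = f p - 1 \<longleftrightarrow> t (colour p) = r (colour p)"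
      if p: "p \<in> B" for p
    proof -
      have "t (colour p) < m"
        using t colour_le[of p] B(2) p by (auto simp: zero_sum_def)
      then show ?thesis
        using add_mod_left_cancel[of "t (colour p)" m "x p" "shift p B"] x[OF p] r[OF p] by simp
    qed
    then show ?thesis
      using in_code_iff[OF supp, of t] by (simp add: B_def)
  qed
  moreover have "\<exists>!t. t \<in> zero_sum w m \<and> (\<forall>c\<in>colour ` B. t c = r c)"
  proof (rule ex1_zero_sum_extension)
    show "colour ` B \<subseteq> {..w}"
      using colour_le B(2) by auto
    show "card (colour ` B) = w"
      using inj B(1) by (simp add: card_image card_block)
    show "r \<in> colour ` B \<rightarrow> {..<m}"
      using x r by auto
  qed (rule degree_pos)
  ultimately show ?thesis
    by (metis (no_types, lifting))
qed

lemma degree_image: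
  assumes inj: "inj_on g V" and p: "p \<in> V"
  shows "card {B' \<in> (`) g ` \<B>. g p \<in> B'} = m"
proof -
  have "g p \<in> g ` B \<longleftrightarrow> p \<in> B" if "B \<in> \<B>" for B
    using inj p block_subset[OF that] by (rule inj_on_image_mem_iff)
  then have "{B' \<in> (`) g ` \<B>. g p \<in> B'} = (`) g ` {B \<in> \<B>. p \<in> B}"
    by blast
  moreover have "inj_on ((`) g) {B \<in> \<B>. p \<in> B}"
    using inj_on_image_eq_iff[OF inj] block_subset by (auto intro: inj_onI)
  ultimately show ?thesis
    using degree[OF p] by (simp add: card_image)
qed

lemma rainbow_configuration_image:
  assumes g: "bij_betw g V V'"
  shows "rainbow_configuration w m V' ((`) g ` \<B>) (colour \<circ> the_inv_into V g)"
proof -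
  note inj = bij_betw_imp_inj_on[OF g]
  have inv: "the_inv_into V g (g p) = p" if "p \<in> V" for p
    using inj that by (rule the_inv_into_f_f)
  have card_image_g: "card (g ` A) = card A" if "A \<subseteq> V" for A
    using inj_on_subset[OF inj that] by (rule card_image)
  show ?thesis
  proof
    fix B' assume "B' \<in> (`) g ` \<B>"
    then obtain B where B: "B \<in> \<B>" "B' = g ` B"
      by blast
    show "B' \<subseteq> V'"
      using B block_subset bij_betw_imp_surj_on[OF g] by blast
    show "card B' = w"
      using B by (simp add: card_image_g block_subset card_block)
    have "inj_on (colour \<circ> the_inv_into V g \<circ> g) B \<longleftrightarrow> inj_on colour B"
      using block_subset[OF B(1)] inv by (intro inj_on_cong) auto
    then show "inj_on (colour \<circ> the_inv_into V g) B'"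
      unfolding B(2) using rainbow[OF B(1)] by (intro inj_on_imageI) simp
    fix D' assume "D' \<in> (`) g ` \<B>" "B' \<noteq> D'"
    then obtain D where D: "D \<in> \<B>" "D' = g ` D" "B \<noteq> D"
      using B by blast
    then have "B' \<inter> D' = g ` (B \<inter> D)"
      using B inj_on_image_Int[OF inj, of B D] block_subset by simp
    then show "card (B' \<inter> D') \<le> 1"
      using card_Int_le_1[OF B(1) D(1,3)] block_subset[OF B(1)] by (simp add: card_image_g le_infI1)
  next
    fix p' assume "p' \<in> V'"
    then obtain p where p: "p \<in> V" "p' = g p"
      using bij_betw_imp_surj_on[OF g] by blast
    then show "(colour \<circ> the_inv_into V g) p' \<le> w"
      using colour_le by (simp add: inv)
    show "card {B' \<in> (`) g ` \<B>. p' \<in> B'} = m"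
      unfolding p(2) using inj p(1) by (rule degree_image)
  qed (use finite_points degree_pos bij_betw_finite[OF g] in auto)
qed

end

lemma tiling_of_configurations:
  fixes V :: "'a set"
  assumes part: "partition_on {B. B \<subseteq> V \<and> card B = w} \<S>"
    and config: "\<And>\<B>. \<B> \<in> \<S> \<Longrightarrow> rainbow_configuration w m V \<B> (colour \<B>)"
  shows "tiling (Suc m) w V (\<S> \<times> zero_sum w m)
    (\<lambda>(\<B>, t). rainbow_configuration.code m \<B> (colour \<B>) t)"
    (is "tiling _ _ _ ?J ?C")
proof (rule tilingI)
  show "saturated_code (Suc m) w V (?C j)" if "j \<in> ?J" for j
    using that config by (auto intro: rainbow_configuration.saturated_code_code)
  show "\<exists>j\<in>?J. f \<in> ?C j" if f: "f \<in> words (Suc m) w V" for f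
  proof -
    have "supp f \<in> \<Union>\<S>"
      using wordsD(2,3)[OF f] partition_onD1[OF part] by auto
    then obtain \<B> where \<B>: "\<B> \<in> \<S>" "supp f \<in> \<B>"
      by blast
    then obtain t where "t \<in> zero_sum w m" "f \<in> rainbow_configuration.code m \<B> (colour \<B>) t"
      using rainbow_configuration.ex1_zero_sum_code[OF config f] by blast
    then show ?thesis
      using \<B>(1) by auto
  qed
  fix i j f assume i: "i \<in> ?J" "f \<in> ?C i" and j: "j \<in> ?J" "f \<in> ?C j"
  obtain \<B> t \<C> u where ij: "i = (\<B>, t)" "j = (\<C>, u)"
    by fastforce
  interpret B: rainbow_configuration w m V \<B> "colour \<B>"
    using config i(1) ij by auto
  interpret C: rainbow_configuration w m V \<C> "colour \<C>"
    using config j(1) ij by auto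
  have "supp f \<in> \<B>" "supp f \<in> \<C>"
    using i(2) j(2) B.supp_code C.supp_code by (auto simp: ij)
  then have "\<B> = \<C>"
    using disjointD[OF partition_onD2[OF part]] i(1) j(1) ij by blast
  moreover have "f \<in> words (Suc m) w V"
    using i(2) B.code_subset_words ij by auto
  ultimately show "i = j"
    using B.ex1_zero_sum_code[of f] \<open>supp f \<in> \<B>\<close> i j ij by auto
qed

lemma tileable_of_configurations:
  assumes V: "finite V" "V \<noteq> {}" and "0 < m"
    and part: "partition_on {B. B \<subseteq> V \<and> card B = w} \<S>"
    and config: "\<And>\<B>. \<B> \<in> \<S> \<Longrightarrow> \<exists>colour. rainbow_configuration w m V \<B> colour"
  shows "tileable (Suc m) w V"
proof -
  have "\<forall>\<B>\<in>\<S>. \<exists>colour. rainbow_configuration w m V \<B> colour"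
    using config by blast
  from bchoice[OF this] obtain colour where
    "\<forall>\<B>\<in>\<S>. rainbow_configuration w m V \<B> (colour \<B>)" ..
  from tiling_of_configurations[OF part bspec[OF this]] show ?thesis
    using V \<open>0 < m\<close> by (intro tiling_imp_tileable) auto
qed

section \<open>Tilings on 8 and 9 points\<close>

definition rotation :: "nat \<Rightarrow> nat \<Rightarrow> nat" where
  "rotation j p = (if p < 7 then (p + j) mod 7 else p)"

definition rotations :: "nat set list list \<Rightarrow> nat set list list" where
  "rotations \<B>s = [map ((`) (rotation j)) \<B>. \<B> \<leftarrow> \<B>s, j \<leftarrow> [0..<7]]"

lemma bij_betw_rotation:
  assumes "7 \<le> v"
  shows "bij_betw (rotation j) {..<v} {..<v}"
proof -
  have "inj_on (rotation j) {..<v}"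
  proof (rule inj_onI)
    fix p p' assume "rotation j p = rotation j p'"
    then show "p = p'"
      using add_mod_left_cancel[of p 7 p' j] mod_less_divisor[of 7 "p + j"]
        mod_less_divisor[of 7 "p' + j"]
      by (auto simp: rotation_def add.commute split: if_splits)
  qed
  moreover have "rotation j ` {..<v} \<subseteq> {..<v}"
    using assms mod_less_divisor[of 7] by (fastforce simp: rotation_def intro: less_le_trans)
  ultimately show ?thesis
    by (simp add: bij_betw_def endo_inj_surj)
qed

lemma partition_on_distinct_concat:
  assumes "distinct (concat xss)" "[] \<notin> set xss"
  shows "partition_on (set (concat xss)) (set ` set xss)"
proof (rule partition_onI)
  show "disjnt A B" if "A \<in> set ` set xss" "B \<in> set ` set xss" "A \<noteq> B" for A B
    using assms(1) that by (auto simp: distinct_concat_iff disjnt_def)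
qed (use assms(2) in auto)

lemma rainbow_configuration_rotations:
  assumes base: "\<And>\<B>. \<B> \<in> set \<B>s \<Longrightarrow> \<exists>colour. rainbow_configuration w m {..<v} (set \<B>) colour"
    and "7 \<le> v" and "\<C> \<in> set (rotations \<B>s)"
  shows "\<exists>colour. rainbow_configuration w m {..<v} (set \<C>) colour"
proof -
  have "\<exists>\<B>\<in>set \<B>s. \<exists>j. set \<C> = (`) (rotation j) ` set \<B>"
    using assms(3) by (force simp: rotations_def)
  then obtain \<B> j where \<B>: "\<B> \<in> set \<B>s" and \<C>: "set \<C> = (`) (rotation j) ` set \<B>"
    by blast
  from base[OF \<B>] obtain colour where "rainbow_configuration w m {..<v} (set \<B>) colour" ..
  then have "rainbow_configuration w m {..<v} ((`) (rotation j) ` set \<B>)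
      (colour \<circ> the_inv_into {..<v} (rotation j))"
    using bij_betw_rotation[OF \<open>7 \<le> v\<close>] by (rule rainbow_configuration.rainbow_configuration_image)
  then show ?thesis
    unfolding \<C> by blast
qed

lemma tileable_of_rotations:
  assumes base: "\<And>\<B>. \<B> \<in> set \<B>s \<Longrightarrow> \<exists>colour. rainbow_configuration w m {..<v} (set \<B>) colour"
    and "7 \<le> v" "0 < m"
    and distinct: "distinct (concat (rotations \<B>s))"
    and length: "length (concat (rotations \<B>s)) = v choose w"
  shows "tileable (Suc m) w {..<v}"
proof -
  note config = rainbow_configuration_rotations[OF base \<open>7 \<le> v\<close>]
  have V: "{..<v} \<noteq> {}"
    using \<open>7 \<le> v\<close> by (simp add: lessThan_empty_iff)
  have "set (concat (rotations \<B>s)) = {B. B \<subseteq> {..<v} \<and> card B = w}"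
  proof (rule card_subset_eq)
    show "set (concat (rotations \<B>s)) \<subseteq> {B. B \<subseteq> {..<v} \<and> card B = w}"
      using config rainbow_configuration.block_subset rainbow_configuration.card_block by fastforce
    show "card (set (concat (rotations \<B>s))) = card {B. B \<subseteq> {..<v} \<and> card B = w}"
      using distinct_card[OF distinct] length by (simp add: n_subsets)
  qed simp
  moreover have "[] \<notin> set (rotations \<B>s)"
    using config rainbow_configuration.blocks_nonempty[OF _ V] by fastforce
  ultimately have "partition_on {B. B \<subseteq> {..<v} \<and> card B = w} (set ` set (rotations \<B>s))"
    using partition_on_distinct_concat[OF distinct] by simp
  then show ?thesis
    using config by (intro tileable_of_configurations[OF _ V \<open>0 < m\<close>]) auto
qed

text \<open>
  These labellings were found by computer. The first configuration is the Moebius-Kantor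
  configuration; in the other two, the points and blocks are the edges and vertices of a triangular
  prism.
\<close>

definition moebius_kantor :: "nat set list" where
  "moebius_kantor =
    [{0, 1, 2}, {2, 3, 5}, {1, 4, 5}, {0, 4, 6}, {3, 4, 7}, {1, 3, 6}, {0, 5, 7}, {2, 6, 7}]"

definition prism_dual\<^sub>1 :: "nat set list" where
  "prism_dual\<^sub>1 = [{0, 1, 2}, {2, 3, 5}, {0, 3, 4}, {5, 6, 7}, {4, 6, 8}, {1, 7, 8}]"

definition prism_dual\<^sub>2 :: "nat set list" where
  "prism_dual\<^sub>2 = [{0, 1, 5}, {1, 2, 8}, {2, 4, 6}, {3, 5, 7}, {0, 4, 7}, {3, 6, 8}]"

lemma rainbow_configuration_lessThanI:
  fixes v :: nat
  assumes "\<forall>B\<in>set \<B>. B \<subseteq> {..<v} \<and> card B = w \<and> inj_on colour B \<and>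
      (\<forall>D\<in>set \<B>. B = D \<or> card (B \<inter> D) \<le> 1)"
    and "\<forall>p\<in>{..<v}. card {B \<in> set \<B>. p \<in> B} = m \<and> colour p \<le> w" and "0 < m"
  shows "rainbow_configuration w m {..<v} (set \<B>) colour"
proof
  show "finite {..<v}"
    by simp
qed (use assms in auto)

lemma rainbow_configuration_moebius_kantor:
  "rainbow_configuration 3 3 {..<8} (set moebius_kantor) ((!) [0, 1, 2, 0, 2, 3, 3, 1])"
  by (rule rainbow_configuration_lessThanI) code_simp+

lemma rainbow_configuration_prism_dual:
  "rainbow_configuration 3 2 {..<9} (set prism_dual\<^sub>1) ((!) [0, 1, 2, 1, 2, 0, 1, 2, 0])"
  "rainbow_configuration 3 2 {..<9} (set prism_dual\<^sub>2) ((!) [0, 1, 0, 0, 2, 2, 1, 1, 2])"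
  by (rule rainbow_configuration_lessThanI; code_simp)+

lemma tileable_8: "tileable 4 3 {..<8::nat}"
proof -
  have "distinct (concat (rotations [moebius_kantor]))"
    "length (concat (rotations [moebius_kantor])) = 8 choose 3"
    by code_simp+
  then have "tileable (Suc 3) 3 {..<8::nat}"
    using rainbow_configuration_moebius_kantor
    by (intro tileable_of_rotations[where \<B>s = "[moebius_kantor]"]) auto
  then show ?thesis
    by simp
qed

lemma tileable_9: "tileable 3 3 {..<9::nat}"
proof -
  have "distinct (concat (rotations [prism_dual\<^sub>1, prism_dual\<^sub>2]))"
    "length (concat (rotations [prism_dual\<^sub>1, prism_dual\<^sub>2])) = 9 choose 3"
    by code_simp+
  then have "tileable (Suc 2) 3 {..<9::nat}"
    using rainbow_configuration_prism_dual
    by (intro tileable_of_rotations[where \<B>s = "[prism_dual\<^sub>1, prism_dual\<^sub>2]"]) auto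
  then show ?thesis
    by simp
qed

section \<open>Roots in algebraically closed fields\<close>

lemma proots_prod_linear: "proots (\<Prod>x\<in>#A. [:-x, 1:]) = (A :: 'a :: idom multiset)"
proof (induction A)
  case (add x A)
  have "(\<Prod>x\<in>#A. [:-x, 1:]) \<noteq> 0"
    by (auto simp: prod_mset_zero_iff)
  with add show ?case
    by (simp add: proots_mult del: mult_pCons_left)
qed simp

lemma size_proots_alg_closed:
  fixes p :: "'a :: alg_closed_field poly"
  assumes "p \<noteq> 0"
  shows "size (proots p) = Polynomial.degree p"
proof -
  obtain A l where A: "size A = Polynomial.degree p" "p = smult l (\<Prod>x\<in>#A. [:-x, 1:])"
    using alg_closed_imp_factorization[OF assms] by blast
  then have "l \<noteq> 0"
    using assms by auto
  then have "proots p = A"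
    unfolding A(2) by (simp add: proots_prod_linear)
  with A(1) show ?thesis by simp
qed

lemma order_eq_1:
  fixes p :: "'a :: idom poly"
  assumes "poly p x = 0" "poly (pderiv p) x \<noteq> 0"
  shows "Polynomial.order x p = 1"
proof (rule antisym)
  have "p \<noteq> 0"
    using assms(2) by auto
  then show "1 \<le> Polynomial.order x p"
    using assms(1) order_root[of p x] by simp
  show "Polynomial.order x p \<le> 1"
  proof (rule ccontr)
    assume "\<not> Polynomial.order x p \<le> 1"
    then obtain r where "p = [:-x, 1:] ^ 2 * r"
      using order_divides[of x 2 p] by (auto elim: dvdE)
    then have "poly (pderiv p) x = 0"
      by (simp add: power2_eq_square pderiv_mult del: mult_pCons_left mult_pCons_right)
    with assms(2) show False ..
  qed
qed

lemma card_roots_separable: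
  fixes p :: "'a :: alg_closed_field poly"
  assumes "p \<noteq> 0" and sep: "\<And>x. poly p x = 0 \<Longrightarrow> poly (pderiv p) x \<noteq> 0"
  shows "card {x. poly p x = 0} = Polynomial.degree p"
proof -
  have "proots p = mset_set {x. poly p x = 0}"
  proof (rule multiset_eqI)
    fix x
    show "count (proots p) x = count (mset_set {x. poly p x = 0}) x"
      using assms(1) order_eq_1[OF _ sep, of x] poly_roots_finite[OF assms(1)]
      by (cases "poly p x = 0") (simp_all add: order_0I)
  qed
  then show ?thesis
    using size_proots_alg_closed[OF assms(1)] by simp
qed

lemma card_power_eq_power:
  assumes "k < N"
    and sep: "\<And>x :: 'a. x ^ N = x ^ k \<Longrightarrow> of_nat N * x ^ (N - 1) \<noteq> of_nat k * x ^ (k - 1)"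
  shows "card {x :: 'a :: alg_closed_field. x ^ N = x ^ k} = N"
proof -
  define p :: "'a poly" where "p = Polynomial.monom 1 N - Polynomial.monom 1 k"
  have degree: "Polynomial.degree p = N"
    unfolding p_def diff_conv_add_uminus using assms(1)
    by (subst degree_add_eq_left) (simp_all add: degree_monom_eq)
  then have "p \<noteq> 0"
    using assms(1) by auto
  moreover have "poly (pderiv p) x \<noteq> 0" if "poly p x = 0" for x
    using that sep by (simp add: p_def pderiv_diff pderiv_monom poly_monom)
  ultimately have "card {x. poly p x = 0} = N"
    using card_roots_separable degree by metis
  then show ?thesis
    by (simp add: p_def poly_monom)
qed

lemma card_roots_unity:
  assumes "of_nat N \<noteq> (0 :: 'a :: alg_closed_field)"
  shows "card {x :: 'a. x ^ N = 1} = N"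
proof -
  have "0 < N"
    using assms by (auto intro: Nat.gr0I)
  then have "card {x :: 'a. x ^ N = x ^ 0} = N"
    using assms by (intro card_power_eq_power) (auto simp: power_0_left)
  then show ?thesis by simp
qed

definition GF :: "nat \<Rightarrow> 'a :: field set" where
  "GF N = {x. x ^ N = x}"

lemma card_GF:
  assumes "of_nat N = (0 :: 'a :: alg_closed_field)" "1 < N"
  shows "card (GF N :: 'a set) = N"
  using card_power_eq_power[where 'a = 'a, of 1 N] assms by (simp add: GF_def)

lemma plus_one_dvd_power_plus_one:
  fixes q :: nat
  assumes "odd n"
  shows "q + 1 dvd q ^ n + 1"
proof -
  have "[int q ^ n = (- 1) ^ n] (mod int (q + 1))"
    by (intro cong_pow) (simp add: cong_iff_dvd_diff add.commute)
  then have "int (q + 1) dvd int (q ^ n + 1)"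
    using assms by (simp add: cong_iff_dvd_diff add.commute)
  then show ?thesis
    by (simp only: of_nat_dvd_iff)
qed

lemma eq_or_eq_of_sum_product:
  fixes a b c d :: "'a :: idom"
  assumes sum: "a + b = c + d" and product: "a * b = c * d"
  shows "c = a \<or> c = b"
proof -
  have "(c - a) * (c - b) = c * c - c * (a + b) + a * b"
    by (simp add: algebra_simps)
  also have "\<dots> = 0"
    unfolding sum product by (simp add: algebra_simps)
  finally show ?thesis
    by simp
qed

section \<open>Parallel classes of sublines\<close>

locale subline_geometry =
  fixes type :: "'a :: alg_closed_field itself" and q n Q :: nat
  assumes q_gt_1: "1 < q" and ex_q_eq_power_CHAR: "\<exists>e. q = CHAR('a) ^ e"
    and odd_n: "odd n" and Q_def: "Q = q ^ n"
begin

lemma prime_CHAR: "Factorial_Ring.prime CHAR('a)"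
proof (rule prime_CHAR_semidom)
  show "0 < CHAR('a)"
    using q_gt_1 ex_q_eq_power_CHAR by (auto simp: power_0_left split: if_splits intro: Nat.gr0I)
qed

lemma Q_gt_1: "1 < Q"
  unfolding Q_def using q_gt_1 odd_pos[OF odd_n] by (rule one_less_power)

lemma of_nat_q [simp]: "of_nat q = (0 :: 'a)"
proof -
  obtain e where e: "q = CHAR('a) ^ e"
    using ex_q_eq_power_CHAR ..
  then have "0 < e"
    using q_gt_1 by (cases e) auto
  then show ?thesis
    by (simp add: e)
qed

lemma of_nat_Q [simp]: "of_nat Q = (0 :: 'a)"
  using odd_pos[OF odd_n] by (simp add: Q_def)

lemma power_q_add: "(x + y :: 'a) ^ q = x ^ q + y ^ q"
  using ex_q_eq_power_CHAR freshmans_dream'[OF prime_CHAR] by metis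

lemma power_Q_add: "(x + y :: 'a) ^ Q = x ^ Q + y ^ Q"
proof -
  obtain e where "q = CHAR('a) ^ e"
    using ex_q_eq_power_CHAR ..
  then have "Q = CHAR('a) ^ (e * n)"
    by (simp add: Q_def power_mult)
  then show ?thesis
    by (rule freshmans_dream'[OF prime_CHAR])
qed

lemma power_q_diff: "(x - y :: 'a) ^ q = x ^ q - y ^ q"
  using power_q_add[of "x - y" y] by simp

lemma power_Q_diff: "(x - y :: 'a) ^ Q = x ^ Q - y ^ Q"
  using power_Q_add[of "x - y" y] by simp

lemma GF_Q_closed [simp, intro]:
  fixes x y :: 'a
  shows
    "(0 :: 'a) \<in> GF Q" "(1 :: 'a) \<in> GF Q"
    "x \<in> GF Q \<Longrightarrow> y \<in> GF Q \<Longrightarrow> x + y \<in> GF Q" "x \<in> GF Q \<Longrightarrow> y \<in> GF Q \<Longrightarrow> x - y \<in> GF Q"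
    "x \<in> GF Q \<Longrightarrow> y \<in> GF Q \<Longrightarrow> x * y \<in> GF Q" "x \<in> GF Q \<Longrightarrow> y \<in> GF Q \<Longrightarrow> x / y \<in> GF Q"
  using Q_gt_1 by (auto simp: GF_def power_Q_add power_Q_diff power_mult_distrib power_divide)

lemma power_Q_GF_Q: "(x :: 'a) \<in> GF Q \<Longrightarrow> x ^ Q = x"
  by (simp add: GF_def)

lemma card_GF_Q: "card (GF Q :: 'a set) = Q"
  by (rule card_GF[OF of_nat_Q Q_gt_1])

definition proj_line :: "'a option set" where
  "proj_line = insert None (Some ` GF Q)"

lemma proj_line_simps [simp]: "None \<in> proj_line" "Some x \<in> proj_line \<longleftrightarrow> x \<in> GF Q"
  by (auto simp: proj_line_def)

lemma finite_proj_line: "finite proj_line" and card_proj_line: "card proj_line = Q + 1"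
proof -
  have "finite (GF Q :: 'a set)"
    using card_GF_Q Q_gt_1 by (intro card_ge_0_finite) simp
  then show "finite proj_line" "card proj_line = Q + 1"
    by (auto simp: proj_line_def card_GF_Q card_image)
qed

definition imaginary :: "'a set" where
  "imaginary = {\<tau>. (\<tau> ^ Q) ^ Q = \<tau> \<and> \<tau> ^ Q \<noteq> \<tau>}"

lemma imaginaryD:
  assumes "\<tau> \<in> imaginary"
  shows "(\<tau> ^ Q) ^ Q = \<tau>" "\<tau> ^ Q \<noteq> \<tau>" "\<tau> ^ Q \<in> imaginary"
    "x \<in> GF Q \<Longrightarrow> x \<noteq> \<tau>" "x \<in> GF Q \<Longrightarrow> x \<noteq> \<tau> ^ Q"
  using assms by (auto simp: imaginary_def GF_def)

lemma finite_imaginary: "finite imaginary"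
proof -
  have "card (GF (Q * Q) :: 'a set) = Q * Q"
    using less_1_mult[OF Q_gt_1 Q_gt_1] by (intro card_GF) simp_all
  then have "finite (GF (Q * Q) :: 'a set)"
    using Q_gt_1 by (intro card_ge_0_finite) simp
  then show ?thesis
    by (rule rev_finite_subset) (auto simp: imaginary_def GF_def power_mult)
qed

fun cayley :: "'a \<Rightarrow> 'a option \<Rightarrow> 'a" where
  "cayley \<tau> None = 1"
| "cayley \<tau> (Some x) = (x - \<tau>) / (x - \<tau> ^ Q)"

lemma cayley_nonzero: "\<tau> \<in> imaginary \<Longrightarrow> x \<in> proj_line \<Longrightarrow> cayley \<tau> x \<noteq> 0"
  by (cases x) (auto dest: imaginaryD(4,5))

lemma cayley_conj: "\<tau> \<in> imaginary \<Longrightarrow> cayley (\<tau> ^ Q) x = inverse (cayley \<tau> x)"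
  by (cases x) (simp_all add: imaginaryD)

lemma cayley_norm:
  assumes \<tau>: "\<tau> \<in> imaginary" and x: "x \<in> proj_line"
  shows "cayley \<tau> x ^ (Q + 1) = 1"
proof (cases x)
  case (Some y)
  then have y: "y \<in> GF Q"
    using x by simp
  have "cayley \<tau> x ^ Q = (y - \<tau> ^ Q) / (y - \<tau>)"
    using \<tau> y by (simp add: Some power_divide power_Q_diff power_Q_GF_Q imaginaryD)
  then show ?thesis
    using imaginaryD(4,5)[OF \<tau> y] by (simp add: Some)
qed simp

lemma inj_on_cayley:
  assumes \<tau>: "\<tau> \<in> imaginary"
  shows "inj_on (cayley \<tau>) proj_line"
proof -
  have "cayley \<tau> (Some x) \<noteq> 1" if "x \<in> GF Q" for x
    using imaginaryD(2)[OF \<tau>] imaginaryD(5)[OF \<tau> that] by (simp add: field_simps)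
  moreover have "x = y" if "x \<in> GF Q" "y \<in> GF Q" "cayley \<tau> (Some x) = cayley \<tau> (Some y)" for x y
  proof -
    have "(x - \<tau>) * (y - \<tau> ^ Q) = (y - \<tau>) * (x - \<tau> ^ Q)"
      using that imaginaryD(5)[OF \<tau>] by (simp add: frac_eq_eq)
    then have "(\<tau> - \<tau> ^ Q) * (x - y) = 0"
      by (simp add: algebra_simps)
    then show ?thesis
      using imaginaryD(2)[OF \<tau>] by auto
  qed
  ultimately show ?thesis
    by (auto simp: inj_on_def proj_line_def simp del: cayley.simps(2))
qed

lemma bij_betw_cayley:
  assumes \<tau>: "\<tau> \<in> imaginary"
  shows "bij_betw (cayley \<tau>) proj_line {u. u ^ (Q + 1) = 1}"
  unfolding bij_betw_def
proof
  have "card {u :: 'a. u ^ (Q + 1) = 1} = Q + 1"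
    by (rule card_roots_unity) simp
  moreover have "card (cayley \<tau> ` proj_line) = Q + 1"
    by (simp add: card_image inj_on_cayley[OF \<tau>] card_proj_line)
  moreover have "finite {u :: 'a. u ^ (Q + 1) = 1}"
    using calculation(1) by (intro card_ge_0_finite) simp
  ultimately show "cayley \<tau> ` proj_line = {u. u ^ (Q + 1) = 1}"
    using cayley_norm[OF \<tau>] by (intro card_subset_eq) auto
qed (rule inj_on_cayley[OF \<tau>])

definition block :: "'a \<Rightarrow> 'a option \<Rightarrow> 'a option set" where
  "block \<tau> x = {y \<in> proj_line. cayley \<tau> y ^ (q + 1) = cayley \<tau> x ^ (q + 1)}"

definition parallel_class :: "'a \<Rightarrow> 'a option set set" where
  "parallel_class \<tau> = block \<tau> ` proj_line"

lemma partition_on_parallel_class: "partition_on proj_line (parallel_class \<tau>)"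
  by (rule partition_onI) (auto simp: parallel_class_def block_def disjnt_def)

lemma parallel_classD:
  assumes "B \<in> parallel_class \<tau>"
  shows "B \<subseteq> proj_line" "x \<in> B \<Longrightarrow> B = block \<tau> x"
  using assms by (auto simp: parallel_class_def block_def)

lemma block_in_parallel_class:
  assumes "x \<in> proj_line"
  shows "block \<tau> x \<in> parallel_class \<tau>" "x \<in> block \<tau> x"
  using assms by (auto simp: parallel_class_def block_def)

lemma parallel_class_conj:
  assumes "\<tau> \<in> imaginary"
  shows "parallel_class (\<tau> ^ Q) = parallel_class \<tau>"
proof -
  have "block (\<tau> ^ Q) = block \<tau>"
    using assms by (intro ext) (simp add: block_def cayley_conj power_inverse del: power_Suc)
  then show ?thesis
    by (simp add: parallel_class_def)
qed

lemma card_block: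
  assumes \<tau>: "\<tau> \<in> imaginary" and x: "x \<in> proj_line"
  shows "card (block \<tau> x) = q + 1"
proof -
  let ?w = "cayley \<tau> x"
  obtain k where k: "Q + 1 = (q + 1) * k"
    using plus_one_dvd_power_plus_one[OF odd_n, of q] by (auto simp: Q_def)
  have "u ^ (Q + 1) = 1" if "u ^ (q + 1) = ?w ^ (q + 1)" for u
    using cayley_norm[OF \<tau> x] that unfolding k power_mult by simp
  then have "{u. u ^ (q + 1) = ?w ^ (q + 1)} \<subseteq> cayley \<tau> ` proj_line"
    using bij_betw_imp_surj_on[OF bij_betw_cayley[OF \<tau>]] by auto
  then have "cayley \<tau> ` block \<tau> x = {u. u ^ (q + 1) = ?w ^ (q + 1)}"
    by (auto simp: block_def simp del: power_Suc)
  moreover have "inj_on (cayley \<tau>) (block \<tau> x)"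
    using inj_on_cayley[OF \<tau>] by (rule inj_on_subset) (auto simp: block_def)
  moreover have "bij_betw ((*) ?w) {u. u ^ (q + 1) = 1} {u. u ^ (q + 1) = ?w ^ (q + 1)}"
    by (rule bij_betw_byWitness[where f' = "\<lambda>u. u / ?w"])
      (use cayley_nonzero[OF \<tau> x] in
        \<open>auto simp: power_mult_distrib power_divide simp del: power_Suc\<close>)
  moreover have "card {u :: 'a. u ^ (q + 1) = 1} = q + 1"
    by (rule card_roots_unity) simp
  ultimately show ?thesis
    using card_image bij_betw_same_card by metis
qed

definition parameters_through :: "'a option set \<Rightarrow> 'a set" where
  "parameters_through A = {\<tau> \<in> imaginary. \<exists>B\<in>parallel_class \<tau>. A \<subseteq> B}"

lemma parameters_through_iff:
  assumes "a \<in> A" "a \<in> proj_line"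
  shows "\<tau> \<in> parameters_through A \<longleftrightarrow> \<tau> \<in> imaginary \<and> A \<subseteq> block \<tau> a"
proof -
  have "B = block \<tau> a" if "B \<in> parallel_class \<tau>" "A \<subseteq> B" for B
    using parallel_classD(2)[OF that(1), of a] that(2) assms(1) by blast
  then show ?thesis
    using block_in_parallel_class(1)[OF assms(2), of \<tau>] by (auto simp: parameters_through_def)
qed

lemma Some_in_block_None_iff:
  assumes \<tau>: "\<tau> \<in> imaginary" and x: "x \<in> GF Q"
  shows "Some x \<in> block \<tau> None \<longleftrightarrow>
    (x - \<tau>) * (x ^ q - \<tau> ^ q) = (x - \<tau> ^ Q) * (x ^ q - (\<tau> ^ Q) ^ q)"
proof -
  have "Some x \<in> block \<tau> None \<longleftrightarrow> (x - \<tau>) ^ (q + 1) = (x - \<tau> ^ Q) ^ (q + 1)"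
    using imaginaryD(5)[OF \<tau> x] x by (auto simp: block_def power_divide simp del: power_Suc)
  then show ?thesis
    by (simp add: power_q_diff)
qed

lemma power_Q_eq_power_q:
  assumes "x \<in> GF (q ^ 2)"
  shows "(x :: 'a) ^ Q = x ^ q"
proof -
  obtain k where k: "n = 2 * k + 1"
    using odd_n by (auto elim: oddE)
  have "x ^ (q ^ 2) ^ j = x" for j
    by (induction j) (use assms in \<open>simp_all add: GF_def power_mult\<close>)
  moreover have "x ^ Q = (x ^ (q ^ 2) ^ k) ^ q"
    by (simp only: Q_def k power_add power_one_right power_mult)
  ultimately show ?thesis
    by simp
qed

lemma quadratic_conj:
  fixes \<tau> :: 'a
  assumes "\<tau> \<in> GF (q ^ 2) - GF q"
  shows "\<tau> ^ Q = \<tau> ^ q" "(\<tau> ^ q) ^ q = \<tau>" "\<tau> ^ q \<noteq> \<tau>"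
  using assms power_Q_eq_power_q by (auto simp: GF_def power2_eq_square power_mult)

lemma GF_q_subset: "GF q \<subseteq> (GF (q ^ 2) :: 'a set)"
  by (auto simp: GF_def power2_eq_square power_mult)

abbreviation standard_triple :: "'a option set" where
  "standard_triple \<equiv> {None, Some 0, Some 1}"

lemma parameters_through_standard_triple:
  "parameters_through standard_triple = GF (q ^ 2) - GF q"
proof (intro equalityI subsetI)
  fix \<tau> assume "\<tau> \<in> parameters_through standard_triple"
  then have \<tau>: "\<tau> \<in> imaginary" and mem: "Some 0 \<in> block \<tau> None" "Some 1 \<in> block \<tau> None"
    by (auto simp: parameters_through_iff[of None])
  have product: "\<tau> * \<tau> ^ q = \<tau> ^ Q * (\<tau> ^ Q) ^ q"
    using mem(1) Some_in_block_None_iff[OF \<tau>, of 0] q_gt_1 by (simp add: power_0_left)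
  have "\<tau> + \<tau> ^ q = \<tau> ^ Q + (\<tau> ^ Q) ^ q"
    using mem(2) Some_in_block_None_iff[OF \<tau>, of 1] product by (simp add: algebra_simps)
  from eq_or_eq_of_sum_product[OF this product] have conj: "\<tau> ^ Q = \<tau> ^ q"
    using imaginaryD(2)[OF \<tau>] by simp
  have "\<tau> ^ (q ^ 2) = (\<tau> ^ q) ^ q"
    by (simp add: power2_eq_square power_mult)
  also have "\<dots> = (\<tau> ^ Q) ^ q"
    by (simp only: conj)
  also have "\<dots> = (\<tau> ^ q) ^ Q"
    by (simp add: mult.commute flip: power_mult)
  also have "\<dots> = \<tau>"
    using imaginaryD(1)[OF \<tau>] by (simp only: conj)
  finally show "\<tau> \<in> GF (q ^ 2) - GF q"
    using conj imaginaryD(2)[OF \<tau>] by (simp add: GF_def)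
next
  fix \<tau> :: 'a assume \<tau>: "\<tau> \<in> GF (q ^ 2) - GF q"
  note conj = quadratic_conj[OF \<tau>]
  have "(\<tau> ^ q) ^ Q = (\<tau> ^ Q) ^ q"
    by (simp add: mult.commute flip: power_mult)
  then have imaginary: "\<tau> \<in> imaginary"
    using conj by (simp add: imaginary_def)
  moreover have "Some 0 \<in> block \<tau> None" "Some 1 \<in> block \<tau> None"
    using q_gt_1
    by (simp_all add: Some_in_block_None_iff[OF imaginary] conj power_0_left algebra_simps)
  ultimately show "\<tau> \<in> parameters_through standard_triple"
    by (simp add: parameters_through_iff[of None] block_in_parallel_class(2))
qed

lemma card_parameters_through_standard_triple:
  "card (parameters_through standard_triple) = q ^ 2 - q"
proof -
  have "card (GF (q ^ 2) :: 'a set) = q ^ 2"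
    using q_gt_1 by (intro card_GF one_less_power) simp_all
  moreover have "card (GF q :: 'a set) = q"
    by (rule card_GF[OF of_nat_q q_gt_1])
  ultimately show ?thesis
    using q_gt_1 GF_q_subset unfolding parameters_through_standard_triple
    by (subst card_Diff_subset) (auto intro: card_ge_0_finite)
qed

lemma imaginary_nonempty: "imaginary \<noteq> {}"
proof
  assume "imaginary = {}"
  then have "card (parameters_through standard_triple) = 0"
    by (simp add: parameters_through_def)
  then show False
    using q_gt_1 by (simp add: card_parameters_through_standard_triple power2_eq_square)
qed

lemma block_of_standard_triple:
  assumes \<tau>: "\<tau> \<in> parameters_through standard_triple"
  shows "block \<tau> None = insert None (Some ` GF q)"
proof -
  have imaginary: "\<tau> \<in> imaginary"
    using \<tau> by (simp add: parameters_through_def)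
  have "\<tau> \<in> GF (q ^ 2) - GF q"
    using \<tau> by (simp only: parameters_through_standard_triple)
  note conj = quadratic_conj[OF this]
  have "Some x \<in> block \<tau> None \<longleftrightarrow> x \<in> GF q" if "x \<in> GF Q" for x
  proof -
    have "Some x \<in> block \<tau> None \<longleftrightarrow> (\<tau> - \<tau> ^ q) * (x - x ^ q) = 0"
      unfolding Some_in_block_None_iff[OF imaginary that] conj(1,2) by (auto simp: algebra_simps)
    then show ?thesis
      using conj(3) by (auto simp: GF_def)
  qed
  moreover have "GF q \<subseteq> (GF Q :: 'a set)"
    using GF_q_subset power_Q_eq_power_q by (auto simp: GF_def)
  ultimately show ?thesis
    by (auto simp: block_def proj_line_def)
qed

end

section \<open>Moebius transformations\<close>

definition linear_fractional :: "'a :: field \<Rightarrow> 'a \<Rightarrow> 'a \<Rightarrow> 'a \<Rightarrow> 'a \<Rightarrow> 'a" where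
  "linear_fractional \<alpha> \<beta> \<gamma> \<delta> x = (\<alpha> * x + \<beta>) / (\<gamma> * x + \<delta>)"

fun moebius :: "'a :: field \<Rightarrow> 'a \<Rightarrow> 'a \<Rightarrow> 'a \<Rightarrow> 'a option \<Rightarrow> 'a option" where
  "moebius \<alpha> \<beta> \<gamma> \<delta> None = (if \<gamma> = 0 then None else Some (\<alpha> / \<gamma>))"
| "moebius \<alpha> \<beta> \<gamma> \<delta> (Some x) =
    (if \<gamma> * x + \<delta> = 0 then None else Some (linear_fractional \<alpha> \<beta> \<gamma> \<delta> x))"

context subline_geometry
begin

definition nonsingular :: "'a \<Rightarrow> 'a \<Rightarrow> 'a \<Rightarrow> 'a \<Rightarrow> bool" where
  "nonsingular \<alpha> \<beta> \<gamma> \<delta> \<longleftrightarrow> {\<alpha>, \<beta>, \<gamma>, \<delta>} \<subseteq> GF Q \<and> \<alpha> * \<delta> - \<beta> * \<gamma> \<noteq> 0"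

context
  fixes \<alpha> \<beta> \<gamma> \<delta> :: 'a
  assumes nonsingular: "nonsingular \<alpha> \<beta> \<gamma> \<delta>"
begin

abbreviation \<mu> :: "'a \<Rightarrow> 'a" where "\<mu> \<equiv> linear_fractional \<alpha> \<beta> \<gamma> \<delta>"
abbreviation M :: "'a option \<Rightarrow> 'a option" where "M \<equiv> moebius \<alpha> \<beta> \<gamma> \<delta>"

lemma coeffs: "\<alpha> \<in> GF Q" "\<beta> \<in> GF Q" "\<gamma> \<in> GF Q" "\<delta> \<in> GF Q"
  and det: "\<alpha> * \<delta> - \<beta> * \<gamma> \<noteq> 0"
  using nonsingular by (simp_all add: nonsingular_def)

lemma denominator_nonzero:
  assumes "\<tau> \<in> imaginary"
  shows "\<gamma> * \<tau> + \<delta> \<noteq> 0"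
proof
  assume eq: "\<gamma> * \<tau> + \<delta> = 0"
  show False
  proof (cases "\<gamma> = 0")
    case True
    then show False
      using eq det by simp
  next
    case False
    then have "\<tau> = (0 - \<delta>) / \<gamma>"
      using eq by (simp add: field_simps add_eq_0_iff)
    then have "\<tau> \<in> GF Q"
      using coeffs by (simp only: GF_Q_closed)
    then show False
      using imaginaryD(4)[OF assms] by blast
  qed
qed

lemma linear_fractional_power_Q: "\<mu> x ^ Q = \<mu> (x ^ Q)"
  by (simp add: linear_fractional_def power_divide power_Q_add power_mult_distrib power_Q_GF_Q
      coeffs)

lemma linear_fractional_diff:
  assumes "\<gamma> * x + \<delta> \<noteq> 0" "\<gamma> * y + \<delta> \<noteq> 0"
  shows "\<mu> x - \<mu> y = (\<alpha> * \<delta> - \<beta> * \<gamma>) * (x - y) / ((\<gamma> * x + \<delta>) * (\<gamma> * y + \<delta>))"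
  using assms by (simp add: linear_fractional_def diff_frac_eq) (simp add: algebra_simps)

lemma linear_fractional_eq_iff:
  assumes "\<gamma> * x + \<delta> \<noteq> 0" "\<gamma> * y + \<delta> \<noteq> 0"
  shows "\<mu> x = \<mu> y \<longleftrightarrow> x = y"
proof -
  have "\<mu> x = \<mu> y \<longleftrightarrow> \<mu> x - \<mu> y = 0"
    by simp
  then show ?thesis
    unfolding linear_fractional_diff[OF assms] using assms det by simp
qed

lemma linear_fractional_imaginary:
  assumes \<tau>: "\<tau> \<in> imaginary"
  shows "\<mu> \<tau> \<in> imaginary"
  using imaginaryD(1,2)[OF \<tau>] denominator_nonzero[OF \<tau>] denominator_nonzero[OF imaginaryD(3)[OF \<tau>]]
    linear_fractional_eq_iff[of "\<tau> ^ Q" \<tau>]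
  by (simp add: imaginary_def linear_fractional_power_Q)

lemma bij_betw_linear_fractional: "bij_betw \<mu> imaginary imaginary"
proof -
  have "inj_on \<mu> imaginary"
    using linear_fractional_eq_iff denominator_nonzero by (auto intro!: inj_onI)
  moreover have "\<mu> ` imaginary \<subseteq> imaginary"
    using linear_fractional_imaginary by blast
  ultimately show ?thesis
    by (simp add: bij_betw_def endo_inj_surj finite_imaginary)
qed

lemma linear_fractional_diff_pole:
  assumes "\<gamma> \<noteq> 0" "\<gamma> * x + \<delta> \<noteq> 0"
  shows "\<alpha> / \<gamma> - \<mu> x = (\<alpha> * \<delta> - \<beta> * \<gamma>) / (\<gamma> * (\<gamma> * x + \<delta>))"
  using assms by (simp add: linear_fractional_def diff_frac_eq) (simp add: algebra_simps)

lemma cayley_moebius: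
  assumes \<tau>: "\<tau> \<in> imaginary" and x: "x \<in> proj_line"
  shows "cayley (\<mu> \<tau>) (M x) = cayley \<tau> x * ((\<gamma> * \<tau> ^ Q + \<delta>) / (\<gamma> * \<tau> + \<delta>))"
proof -
  note nonzero = denominator_nonzero[OF \<tau>] denominator_nonzero[OF imaginaryD(3)[OF \<tau>]]
  consider (infinity) "x = None" "\<gamma> = 0" | (infinity_to_finite) "x = None" "\<gamma> \<noteq> 0"
    | (pole) y where "x = Some y" "\<gamma> * y + \<delta> = 0"
    | (finite) y where "x = Some y" "\<gamma> * y + \<delta> \<noteq> 0"
    by (cases x) blast+
  then show ?thesis
  proof cases
    case infinity
    then show ?thesis
      using det by simp
  next
    case infinity_to_finite
    then show ?thesis
      using nonzero det linear_fractional_diff_pole by (simp add: linear_fractional_power_Q)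
  next
    case (pole y)
    then have "\<delta> = - (\<gamma> * y)"
      by (simp add: eq_neg_iff_add_eq_0 add.commute)
    then have "\<gamma> * z + \<delta> = - (\<gamma> * (y - z))" for z
      by (simp add: algebra_simps)
    moreover have "\<gamma> \<noteq> 0"
      using \<open>\<delta> = - (\<gamma> * y)\<close> det by auto
    moreover have "y \<noteq> \<tau>" "y \<noteq> \<tau> ^ Q"
      using pole imaginaryD(4,5)[OF \<tau>] x by auto
    ultimately show ?thesis
      using pole by simp
  next
    case (finite y)
    then show ?thesis
      using nonzero det linear_fractional_diff[of y] by (simp add: linear_fractional_power_Q)
  qed
qed

lemma cayley_moebius_proportional:
  assumes \<tau>: "\<tau> \<in> imaginary"
  obtains r where "r \<noteq> 0" "\<And>x. x \<in> proj_line \<Longrightarrow> cayley (\<mu> \<tau>) (M x) = cayley \<tau> x * r"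
proof
  show "(\<gamma> * \<tau> ^ Q + \<delta>) / (\<gamma> * \<tau> + \<delta>) \<noteq> 0"
    using denominator_nonzero[OF \<tau>] denominator_nonzero[OF imaginaryD(3)[OF \<tau>]] by simp
qed (rule cayley_moebius[OF \<tau>])

lemma bij_betw_moebius: "bij_betw M proj_line proj_line"
proof -
  have "M x \<in> proj_line" if "x \<in> proj_line" for x
    using that coeffs by (cases x) (auto simp: linear_fractional_def)
  moreover have "inj_on M proj_line"
  proof -
    obtain \<tau> where \<tau>: "\<tau> \<in> imaginary"
      using imaginary_nonempty by blast
    obtain r where "r \<noteq> 0" and r: "\<And>x. x \<in> proj_line \<Longrightarrow> cayley (\<mu> \<tau>) (M x) = cayley \<tau> x * r"
      by (rule cayley_moebius_proportional[OF \<tau>]) blast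
    show ?thesis
    proof (rule inj_onI)
      fix x y assume xy: "x \<in> proj_line" "y \<in> proj_line" "M x = M y"
      then have "cayley \<tau> x = cayley \<tau> y"
        using r[OF xy(1)] r[OF xy(2)] \<open>r \<noteq> 0\<close> by simp
      then show "x = y"
        using inj_onD[OF inj_on_cayley[OF \<tau>]] xy(1,2) by blast
    qed
  qed
  ultimately show ?thesis
    by (simp add: bij_betw_def endo_inj_surj finite_proj_line image_subset_iff)
qed

lemma block_moebius:
  assumes \<tau>: "\<tau> \<in> imaginary" and x: "x \<in> proj_line"
  shows "block (\<mu> \<tau>) (M x) = M ` block \<tau> x"
proof -
  obtain r where "r \<noteq> 0" and r: "\<And>y. y \<in> proj_line \<Longrightarrow> cayley (\<mu> \<tau>) (M y) = cayley \<tau> y * r"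
    by (rule cayley_moebius_proportional[OF \<tau>]) blast
  then have "M y \<in> block (\<mu> \<tau>) (M x) \<longleftrightarrow> y \<in> block \<tau> x" if "y \<in> proj_line" for y
    using that x bij_betwE[OF bij_betw_moebius]
    by (simp add: block_def power_mult_distrib del: power_Suc)
  moreover have "block (\<mu> \<tau>) (M x) \<subseteq> M ` proj_line" "block \<tau> x \<subseteq> proj_line"
    by (auto simp: block_def bij_betw_imp_surj_on[OF bij_betw_moebius])
  ultimately show ?thesis
    by blast
qed

lemma parallel_class_moebius:
  assumes "\<tau> \<in> imaginary"
  shows "parallel_class (\<mu> \<tau>) = (`) M ` parallel_class \<tau>"
proof -
  have "parallel_class (\<mu> \<tau>) = (\<lambda>x. block (\<mu> \<tau>) (M x)) ` proj_line"
    unfolding parallel_class_def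
    by (subst bij_betw_imp_surj_on[OF bij_betw_moebius, symmetric]) (simp add: image_image)
  then show ?thesis
    by (simp add: parallel_class_def image_image block_moebius[OF assms])
qed

lemma parameters_through_moebius:
  assumes "A \<subseteq> proj_line"
  shows "parameters_through (M ` A) = \<mu> ` parameters_through A"
proof -
  have "M ` A \<subseteq> M ` B \<longleftrightarrow> A \<subseteq> B" if "B \<in> parallel_class \<tau>" for B \<tau>
    using inj_on_image_mem_iff[OF bij_betw_imp_inj_on[OF bij_betw_moebius]] assms
      parallel_classD(1)[OF that] by blast
  then have "\<mu> \<tau> \<in> parameters_through (M ` A) \<longleftrightarrow> \<tau> \<in> parameters_through A"
    if "\<tau> \<in> imaginary" for \<tau>
    using that linear_fractional_imaginary[OF that]
    by (auto simp: parameters_through_def parallel_class_moebius[OF that])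
  moreover have "parameters_through (M ` A) \<subseteq> \<mu> ` imaginary" "parameters_through A \<subseteq> imaginary"
    by (auto simp: parameters_through_def bij_betw_imp_surj_on[OF bij_betw_linear_fractional])
  ultimately show ?thesis
    by blast
qed

end

lemma moebius_triply_transitive:
  assumes A: "A \<subseteq> proj_line" "card A = 3"
  obtains \<alpha> \<beta> \<gamma> \<delta> where "nonsingular \<alpha> \<beta> \<gamma> \<delta>" "A = moebius \<alpha> \<beta> \<gamma> \<delta> ` standard_triple"
proof (cases "None \<in> A")
  case True
  then have "card (A - {None}) = 2"
    using A(2) by simp
  then obtain u v where uv: "A - {None} = {u, v}" "u \<noteq> v"
    by (auto simp: card_2_iff)
  have "u \<in> A - {None}" "v \<in> A - {None}"
    by (simp_all add: uv(1))
  then obtain y z where yz: "u = Some y" "v = Some z"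
    by auto
  have "A = insert None (A - {None})"
    using True by blast
  then have "A = {None, Some y, Some z}" "y \<noteq> z"
    using uv(2) yz by (simp_all add: uv(1))
  then show ?thesis
    using that[of "z - y" y 0 1] A(1) by (simp add: nonsingular_def linear_fractional_def)
next
  case False
  obtain u v w where "A = {u, v, w}" "u \<noteq> v" "v \<noteq> w" "u \<noteq> w"
    using A(2) by (auto simp: card_3_iff)
  then obtain x y z where A': "A = {Some x, Some y, Some z}" and neq: "x \<noteq> y" "y \<noteq> z" "x \<noteq> z"
    using False by (cases u; cases v; cases w) auto
  let ?\<alpha> = "x * (z - y)" and ?\<beta> = "y * (x - z)" and ?\<gamma> = "z - y" and ?\<delta> = "x - z"
  have "?\<alpha> * ?\<delta> - ?\<beta> * ?\<gamma> = (x - y) * (z - y) * (x - z)"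
    by (simp add: algebra_simps)
  moreover have "moebius ?\<alpha> ?\<beta> ?\<gamma> ?\<delta> None = Some x" "moebius ?\<alpha> ?\<beta> ?\<gamma> ?\<delta> (Some 0) = Some y"
    using neq by (simp_all add: linear_fractional_def)
  moreover have "?\<alpha> + ?\<beta> = z * (x - y)"
    by (simp add: algebra_simps)
  then have "moebius ?\<alpha> ?\<beta> ?\<gamma> ?\<delta> (Some 1) = Some z"
    using neq by (simp add: linear_fractional_def)
  ultimately show ?thesis
    using that[of ?\<alpha> ?\<beta> ?\<gamma> ?\<delta>] A(1) neq by (simp add: A' nonsingular_def del: moebius.simps)
qed

lemma card_parameters_through:
  assumes "A \<subseteq> proj_line" "card A = 3"
  shows "card (parameters_through A) = q ^ 2 - q"
proof -
  obtain \<alpha> \<beta> \<gamma> \<delta> where M: "nonsingular \<alpha> \<beta> \<gamma> \<delta>"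
    and A: "A = moebius \<alpha> \<beta> \<gamma> \<delta> ` standard_triple"
    using moebius_triply_transitive[OF assms] .
  have "inj_on (linear_fractional \<alpha> \<beta> \<gamma> \<delta>) (parameters_through standard_triple)"
    using bij_betw_imp_inj_on[OF bij_betw_linear_fractional[OF M]]
    by (rule inj_on_subset) (auto simp: parameters_through_def)
  then show ?thesis
    using parameters_through_moebius[OF M, of standard_triple]
      card_parameters_through_standard_triple
    by (simp add: A card_image)
qed

lemma block_unique:
  assumes \<sigma>: "\<sigma> \<in> imaginary" "B \<in> parallel_class \<sigma>"
    and \<tau>: "\<tau> \<in> imaginary" "D \<in> parallel_class \<tau>"
    and A: "A \<subseteq> B \<inter> D" "card A = 3"
  shows "B = D"
proof -
  have "A \<subseteq> proj_line"
    using A(1) parallel_classD(1)[OF \<sigma>(2)] by blast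
  then obtain \<alpha> \<beta> \<gamma> \<delta> where M: "nonsingular \<alpha> \<beta> \<gamma> \<delta>"
    and A': "A = moebius \<alpha> \<beta> \<gamma> \<delta> ` standard_triple"
    using moebius_triply_transitive A(2) by metis
  have "C = moebius \<alpha> \<beta> \<gamma> \<delta> ` insert None (Some ` GF q)"
    if C: "\<upsilon> \<in> imaginary" "C \<in> parallel_class \<upsilon>" "A \<subseteq> C" for \<upsilon> C
  proof -
    have "\<upsilon> \<in> parameters_through A"
      using C by (auto simp: parameters_through_def)
    then obtain \<tau>' where \<tau>': "\<tau>' \<in> parameters_through standard_triple"
        "\<upsilon> = linear_fractional \<alpha> \<beta> \<gamma> \<delta> \<tau>'"
      using parameters_through_moebius[OF M, of standard_triple] by (auto simp: A')
    have "C = block \<upsilon> (moebius \<alpha> \<beta> \<gamma> \<delta> None)"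
      using parallel_classD(2)[OF C(2)] C(3) by (auto simp: A')
    also have "\<dots> = moebius \<alpha> \<beta> \<gamma> \<delta> ` block \<tau>' None"
      unfolding \<tau>'(2) using \<tau>'(1) by (intro block_moebius[OF M]) (auto simp: parameters_through_def)
    finally show ?thesis
      by (simp only: block_of_standard_triple[OF \<tau>'(1)])
  qed
  then show ?thesis
    using \<sigma> \<tau> A(1) by blast
qed

section \<open>Tilings on the projective line\<close>

definition conj_pair :: "'a \<Rightarrow> 'a set" where
  "conj_pair \<tau> = {\<tau>, \<tau> ^ Q}"

definition class_of_pair :: "'a set \<Rightarrow> 'a option set set" where
  "class_of_pair i = (\<Union>\<tau>\<in>i. parallel_class \<tau>)"

lemma class_of_pair_conj_pair: "\<tau> \<in> imaginary \<Longrightarrow> class_of_pair (conj_pair \<tau>) = parallel_class \<tau>"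
  by (simp add: class_of_pair_def conj_pair_def parallel_class_conj)

lemma conj_pair_eq:
  assumes "\<sigma> \<in> imaginary" "\<tau> \<in> conj_pair \<sigma>"
  shows "conj_pair \<tau> = conj_pair \<sigma>"
  using assms(2) unfolding conj_pair_def
  by (elim insertE) (simp_all add: imaginaryD(1)[OF assms(1)] insert_commute)

lemma card_conj_pairs:
  assumes S: "S \<subseteq> imaginary" and conj: "\<And>\<tau>. \<tau> \<in> S \<Longrightarrow> \<tau> ^ Q \<in> S"
  shows "2 * card (conj_pair ` S) = card S"
proof -
  have "finite S"
    using S finite_imaginary by (rule finite_subset)
  have Union: "\<Union>(conj_pair ` S) = S"
    using conj by (auto simp: conj_pair_def)
  have "2 * card (conj_pair ` S) = card (\<Union>(conj_pair ` S))"
  proof (rule card_partition)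
    show "card c = 2" if "c \<in> conj_pair ` S" for c
      using that S imaginaryD(2) by (fastforce simp: conj_pair_def card_2_iff)
    show "c \<inter> d = {}" if cd: "c \<in> conj_pair ` S" "d \<in> conj_pair ` S" "c \<noteq> d" for c d
    proof -
      have "conj_pair \<tau> = c" if "c \<in> conj_pair ` S" "\<tau> \<in> c" for \<tau> c
        using that S conj_pair_eq by auto
      then show ?thesis
        using cd by blast
    qed
  qed (simp_all only: Union \<open>finite S\<close> finite_imageI)
  then show ?thesis
    by (simp only: Union)
qed

lemma card_parameters_of_block:
  assumes \<tau>: "\<tau> \<in> imaginary" and B: "B \<in> parallel_class \<tau>"
  shows "card {\<sigma> \<in> imaginary. B \<in> parallel_class \<sigma>} = q ^ 2 - q"
proof -
  have "card B = q + 1"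
    using B card_block[OF \<tau>] by (auto simp: parallel_class_def)
  then have "3 \<le> card B"
    using q_gt_1 by simp
  then obtain A where A: "A \<subseteq> B" "card A = 3"
    using obtain_subset_with_card_n by metis
  have "D = B" if "\<sigma> \<in> imaginary" "D \<in> parallel_class \<sigma>" "A \<subseteq> D" for \<sigma> D
    using block_unique[OF that(1,2) \<tau> B, of A] that(3) A by blast
  then have "{\<sigma> \<in> imaginary. B \<in> parallel_class \<sigma>} = parameters_through A"
    using A(1) by (auto simp: parameters_through_def)
  then show ?thesis
    using card_parameters_through[OF subset_trans[OF A(1) parallel_classD(1)[OF B]] A(2)] by simp
qed

lemma multiresolution_sublines:
  "multiresolution proj_line 3 (q + 1) (q choose 2) (conj_pair ` imaginary) class_of_pair"
proof
  show "partition_on proj_line (class_of_pair i)" if "i \<in> conj_pair ` imaginary" for i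
    using that partition_on_parallel_class by (auto simp: class_of_pair_conj_pair)
  show "card B = q + 1" if "i \<in> conj_pair ` imaginary" "B \<in> class_of_pair i" for i B
    using that card_block by (auto simp: class_of_pair_conj_pair parallel_class_def)
  show "card {j \<in> conj_pair ` imaginary. B \<in> class_of_pair j} = q choose 2"
    if "i \<in> conj_pair ` imaginary" "B \<in> class_of_pair i" for i B
  proof -
    let ?S = "{\<sigma> \<in> imaginary. B \<in> parallel_class \<sigma>}"
    have "{j \<in> conj_pair ` imaginary. B \<in> class_of_pair j} = conj_pair ` ?S"
      by (auto simp: class_of_pair_conj_pair)
    moreover have "2 * card (conj_pair ` ?S) = card ?S"
      by (rule card_conj_pairs) (auto simp: imaginaryD(3) parallel_class_conj)
    moreover have "card ?S = q ^ 2 - q"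
      using that card_parameters_of_block by (auto simp: class_of_pair_conj_pair)
    ultimately show ?thesis
      by (simp add: choose_two power2_eq_square right_diff_distrib')
  qed
  show "\<exists>i\<in>conj_pair ` imaginary. \<exists>B\<in>class_of_pair i. A \<subseteq> B" if "A \<subseteq> proj_line" "card A = 3" for A
  proof -
    have "card (parameters_through A) \<noteq> 0"
      using card_parameters_through[OF that] q_gt_1 by (simp add: power2_eq_square)
    then obtain \<tau> where "\<tau> \<in> parameters_through A"
      by (metis card.empty ex_in_conv)
    then show ?thesis
      by (auto simp: parameters_through_def class_of_pair_conj_pair)
  qed
  show "B = D"
    if i: "i \<in> conj_pair ` imaginary" "B \<in> class_of_pair i"
      and j: "j \<in> conj_pair ` imaginary" "D \<in> class_of_pair j"
      and A: "A \<subseteq> B \<inter> D" "card A = 3" for i j B D A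
  proof -
    obtain \<sigma> \<tau> where "\<sigma> \<in> imaginary" "i = conj_pair \<sigma>" "\<tau> \<in> imaginary" "j = conj_pair \<tau>"
      using i(1) j(1) by blast
    then show ?thesis
      using block_unique[OF _ _ _ _ A] i(2) j(2) by (simp add: class_of_pair_conj_pair)
  qed
qed (simp_all add: finite_proj_line finite_imaginary)

lemma TOC_of_subline_tiling:
  assumes "tileable r 3 {..<q + 1}" and "1 < r"
  shows "\<exists>P. is_TOC r (Q + 1) 5 3 P"
proof -
  have nonempty: "proj_line \<noteq> {}"
    using proj_line_simps(1) by blast
  interpret multiresolution proj_line 3 "q + 1" "q choose 2" "conj_pair ` imaginary" class_of_pair
    by (rule multiresolution_sublines)
  have "tileable r 3 proj_line"
    using tileable_of_block[OF assms(1) nonempty _ \<open>1 < r\<close>] by simp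
  then show ?thesis
    using tileable_imp_TOC[OF _ finite_proj_line nonempty \<open>1 < r\<close>, of 3]
    by (simp add: card_proj_line)
qed

end

typedef seven = "{0..<7 :: nat}"
  by (rule exI[of _ 0]) simp

lemma card_seven: "CARD(seven) = 7"
  using type_definition.card[OF type_definition_seven] by simp

instance seven :: prime_card
  by standard (simp add: card_seven)

theorem theorem4p13:
  fixes n :: nat
  assumes "odd n"
  shows "(\<exists>P. is_TOC 4 (7 ^ n + 1) 5 3 P) \<and> (\<exists>P. is_TOC 3 (8 ^ n + 1) 5 3 P)"
proof
  interpret F\<^sub>7: subline_geometry "TYPE(seven mod_ring alg_closure)" 7 n "7 ^ n"
    by standard (use assms in \<open>auto simp: card_seven intro!: exI[of _ 1]\<close>)
  show "\<exists>P. is_TOC 4 (7 ^ n + 1) 5 3 P"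
    using F\<^sub>7.TOC_of_subline_tiling tileable_8 by simp
next
  interpret F\<^sub>8: subline_geometry "TYPE(bool mod_ring alg_closure)" 8 n "8 ^ n"
    by standard (use assms in \<open>auto intro!: exI[of _ 3]\<close>)
  show "\<exists>P. is_TOC 3 (8 ^ n + 1) 5 3 P"
    using F\<^sub>8.TOC_of_subline_tiling tileable_9 by simp
qed

end
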